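(* There exists a (randomized) online algorithm for the Machine Covering problem on $m$ identical parallel machines whose competitive ratio in the random-order model is $\tilde{O}(\sqrt[4]{m})$, i.e. $O(\sqrt[4]{m}\cdot \mathrm{polylog}(m))$.
   Context: Machine Covering: an input is a set $\mathcal{J}=\{J_1,\dots,J_n\}$ of jobs with non-negative sizes $p_1,\dots,p_n$, to be assigned to $m$ identical parallel machines; the load of a machine is the total size of jobs assigned to it, and the objective is to maximize the minimum machine load. $\mathrm{OPT}(\mathcal{J})$ denotes the optimal (offline) minimum load. In the online version jobs are revealed one by one and each must be assigned permanently to a machine before the next one is revealed; the algorithm knows $n$ in advance. In the random-order model the adversary chooses the input set $\mathcal{J}$, and the arrival order is a permutation $\sigma$ chosen uniformly at random from the symmetric group $S_n$. For an online algorithm $A$, let $A(\mathcal{J}^\sigma)$ be its (expected, if $A$ is randomized) minimum load on the order $\sigma$, and $A^{\mathrm{rom}}(\mathcal{J})=\mathbb{E}_{\sigma\sim S_n}[A(\mathcal{J}^\sigma)]$. The competitive ratio of $A$ in the random-order model is $\sup_{\mathcal{J}} \mathrm{OPT}(\mathcal{J})/A^{\mathrm{rom}}(\mathcal{J})$, with the conventions $0/0=1$ and $a/0=\infty$ for $a>0$. *)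

theory Defs
  imports "HOL-Probability.Probability" "HOL-Combinatorics.Permutations"
begin

text \<open>A randomized online algorithm (behavioural strategy): given the total number n of jobs,
  the sizes of the jobs revealed so far, the machines they were assigned to, and the size of
  the current job, it returns a probability distribution over machine indices.\<close>
type_synonym online_alg = "nat \<Rightarrow> real list \<Rightarrow> nat list \<Rightarrow> real \<Rightarrow> nat pmf"

definition valid_alg :: "nat \<Rightarrow> online_alg \<Rightarrow> bool" where
  "valid_alg m A \<longleftrightarrow> (\<forall>n ps as x. set_pmf (A n ps as x) \<subseteq> {..<m})"

fun run_alg :: "online_alg \<Rightarrow> nat \<Rightarrow> real list \<Rightarrow> nat list \<Rightarrow> real list \<Rightarrow> nat list pmf" where
  "run_alg A n ps as [] = return_pmf as"
| "run_alg A n ps as (x # xs) =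
     bind_pmf (A n ps as x) (\<lambda>i. run_alg A n (ps @ [x]) (as @ [i]) xs)"

definition load :: "real list \<Rightarrow> nat list \<Rightarrow> nat \<Rightarrow> real" where
  "load xs as j = (\<Sum>i<length xs. if as ! i = j then xs ! i else 0)"

definition min_load :: "nat \<Rightarrow> real list \<Rightarrow> nat list \<Rightarrow> real" where
  "min_load m xs as = Min (load xs as ` {..<m})"

definition OPT :: "nat \<Rightarrow> real list \<Rightarrow> real" where
  "OPT m ps = Max (min_load m ps ` {as. length as = length ps \<and> set as \<subseteq> {..<m}})"

definition arrival :: "real list \<Rightarrow> (nat \<Rightarrow> nat) \<Rightarrow> real list" where
  "arrival ps \<sigma> = map (\<lambda>i. ps ! \<sigma> i) [0..<length ps]"

definition alg_value :: "nat \<Rightarrow> online_alg \<Rightarrow> real list \<Rightarrow> real" where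
  "alg_value m A xs = measure_pmf.expectation (run_alg A (length xs) [] [] xs) (min_load m xs)"

definition rom_value :: "nat \<Rightarrow> online_alg \<Rightarrow> real list \<Rightarrow> real" where
  "rom_value m A ps = measure_pmf.expectation (pmf_of_set {\<sigma>. \<sigma> permutes {..<length ps}})
      (\<lambda>\<sigma>. alg_value m A (arrival ps \<sigma>))"

definition ratio :: "real \<Rightarrow> real \<Rightarrow> ereal" where
  "ratio a b = (if b = 0 then (if a = 0 then 1 else \<infinity>) else ereal (a / b))"

definition comp_ratio :: "nat \<Rightarrow> online_alg \<Rightarrow> ereal" where
  "comp_ratio m A = (SUP ps \<in> {ps. \<forall>x\<in>set ps. 0 \<le> x}. ratio (OPT m ps) (rom_value m A ps))"

end

theory Submission
  imports Defs
begin

text \<open>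
  Let q be about the fourth root of m. There is a scale y, at least OPT/8, such that the jobs
  smaller than y have total volume at least 8 y d and at most 16 y m, where m - d is the number of
  jobs of size at least y. If m jobs have size at least y/(8q), the greedy strategy covers every
  machine with load y/(8q).

  Otherwise, guess d up to a factor 2 by a power of two e and reserve e machines for small jobs. The
  first half of the jobs is a sample and is assigned greedily to the other machines; afterwards jobs
  below a threshold T go to the reserved machines and all others to the remaining ones, each time to
  a least loaded machine. This gives minimum load y/4 as soon as T lies between y/4 and y/2. To find
  such a T, look at the window of jobs with ranks between m and m + 8q in decreasing order of size.
  These jobs, and all later ones, are smaller than y/(8q), so the jobs after the window still have
  volume at least 6 y d, and the sample sees a constant fraction of that volume. Hence the volume
  V of the sample jobs below any job in the window is between y and 16 y m up to constants, and T is
  V divided by a power of two that is guessed among logarithmically many. By Chebyshev's inequality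
  the number of sample jobs of rank below m deviates from m/2 by O(q^2), and the window contains at
  least q sample jobs. So one of O(q) equidistant ranks in the sample hits the window, and guessing
  it succeeds with probability of order 1/q.
\<close>

section \<open>Mixed strategies as behavioural strategies\<close>

type_synonym det_alg = "nat \<Rightarrow> real list \<Rightarrow> nat list \<Rightarrow> real \<Rightarrow> nat"

fun run_det :: "det_alg \<Rightarrow> nat \<Rightarrow> real list \<Rightarrow> nat list \<Rightarrow> real list \<Rightarrow> nat list" where
  "run_det f n ps as [] = as"
| "run_det f n ps as (x # xs) = run_det f n (ps @ [x]) (as @ [f n ps as x]) xs"

definition consistent :: "('s \<Rightarrow> det_alg) \<Rightarrow> nat \<Rightarrow> real list \<Rightarrow> nat list \<Rightarrow> 's set" where
  "consistent f n ps as = {s. \<forall>t<length as. as ! t = f s n (take t ps) (take t as) (ps ! t)}"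

text \<open>The history alone must drive the algorithm, so the seed of a mixed strategy is redrawn at every
  step from its distribution conditioned on the assignments made so far (Kuhn's theorem). On histories
  of probability zero the unconditioned distribution is used.\<close>

definition behavioural :: "'s pmf \<Rightarrow> ('s \<Rightarrow> det_alg) \<Rightarrow> online_alg" where
  "behavioural P f n ps as x =
     map_pmf (\<lambda>s. f s n ps as x)
       (if set_pmf P \<inter> consistent f n ps as = {} then P else cond_pmf P (consistent f n ps as))"

lemma consistent_snoc:
  assumes "length ps = length as"
  shows "consistent f n (ps @ [x]) (as @ [i]) = consistent f n ps as \<inter> {s. f s n ps as x = i}"
  using assms by (auto simp: consistent_def less_Suc_eq nth_append)

lemma cond_pmf_cond_pmf:
  assumes "set_pmf P \<inter> (A \<inter> B) \<noteq> {}"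
  shows "cond_pmf (cond_pmf P A) B = cond_pmf P (A \<inter> B)"
proof (rule pmf_eqI)
  fix s
  have A: "set_pmf P \<inter> A \<noteq> {}" using assms by auto
  have B: "set_pmf (cond_pmf P A) \<inter> B \<noteq> {}" using assms by (auto simp: set_cond_pmf[OF A])
  have pos: "measure P A \<noteq> 0"
    using A by (simp add: measure_pmf_zero_iff)
  have "measure (cond_pmf P A) B = measure P (A \<inter> B) / measure P A"
    using pos by (simp add: cond_pmf.rep_eq[OF A] measure_pmf.emeasure_eq_measure)
  then show "pmf (cond_pmf (cond_pmf P A) B) s = pmf (cond_pmf P (A \<inter> B)) s"
    using pos by (simp add: pmf_cond[OF A] pmf_cond[OF B] pmf_cond[OF assms])
qed

text \<open>Law of total probability for the fibres of \<open>g\<close>: redrawing a seed within its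
  own fibre leaves its distribution unchanged. This makes the redrawing in
  \<open>behavioural\<close> harmless.\<close>

lemma bind_cond_pmf_fibres: "bind_pmf Q (\<lambda>s. cond_pmf Q {t. g s = g t}) = Q"
  by (rule bind_cond_pmf_cancel) (auto simp: eq_commute)

text \<open>Each new assignment intersects the set of consistent seeds with a fibre of the next
  decision. So the next step redraws from the current distribution conditioned on that fibre, and
  \<open>bind_cond_pmf_fibres\<close> removes the redrawing.\<close>

lemma run_alg_behavioural_aux:
  assumes "length ps = length as" "set_pmf P \<inter> consistent f n ps as \<noteq> {}"
  shows "run_alg (behavioural P f) n ps as xs =
    map_pmf (\<lambda>s. run_det (f s) n ps as xs) (cond_pmf P (consistent f n ps as))"
  using assms
proof (induction xs arbitrary: ps as)
  case Nil
  then show ?case by simp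
next
  case (Cons x xs)
  let ?C = "consistent f n ps as"
  let ?Q = "cond_pmf P ?C"
  let ?g = "\<lambda>s. f s n ps as x"
  let ?H = "\<lambda>s. run_det (f s) n (ps @ [x]) (as @ [?g s]) xs"
  have "run_alg (behavioural P f) n ps as (x # xs) =
      bind_pmf ?Q (\<lambda>s. run_alg (behavioural P f) n (ps @ [x]) (as @ [?g s]) xs)"
    using Cons.prems by (simp add: behavioural_def bind_map_pmf)
  also have "\<dots> = bind_pmf ?Q (\<lambda>s. map_pmf ?H (cond_pmf ?Q {t. ?g s = ?g t}))"
  proof (intro bind_pmf_cong refl)
    fix s assume "s \<in> set_pmf ?Q"
    then have s: "s \<in> set_pmf P \<inter> ?C" using Cons.prems by simp
    have C: "consistent f n (ps @ [x]) (as @ [?g s]) = ?C \<inter> {t. ?g s = ?g t}"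
      using Cons.prems by (auto simp: consistent_snoc)
    have ne: "set_pmf P \<inter> (?C \<inter> {t. ?g s = ?g t}) \<noteq> {}" using s by auto
    have "run_alg (behavioural P f) n (ps @ [x]) (as @ [?g s]) xs =
      map_pmf (\<lambda>t. run_det (f t) n (ps @ [x]) (as @ [?g s]) xs) (cond_pmf P (?C \<inter> {t. ?g s = ?g t}))"
      using Cons.IH[of "ps @ [x]" "as @ [?g s]"] Cons.prems ne by (simp add: C)
    also have "\<dots> = map_pmf ?H (cond_pmf P (?C \<inter> {t. ?g s = ?g t}))"
      by (rule map_pmf_cong) (auto simp: set_cond_pmf[OF ne])
    finally show "run_alg (behavioural P f) n (ps @ [x]) (as @ [?g s]) xs =
      map_pmf ?H (cond_pmf ?Q {t. ?g s = ?g t})"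
      by (simp add: cond_pmf_cond_pmf[OF ne])
  qed
  also have "\<dots> = map_pmf ?H ?Q"
    by (simp only: map_bind_pmf[symmetric] bind_cond_pmf_fibres)
  finally show ?case by simp
qed

lemma run_alg_behavioural:
  "run_alg (behavioural P f) n [] [] xs = map_pmf (\<lambda>s. run_det (f s) n [] [] xs) P"
proof -
  have [simp]: "consistent f n [] [] = UNIV" by (auto simp: consistent_def)
  have "cond_pmf P UNIV = P"
    by (rule pmf_eqI) (simp add: pmf_cond set_pmf_not_empty)
  then show ?thesis
    using run_alg_behavioural_aux[of "[]" "[]" P f n xs] by (simp add: set_pmf_not_empty)
qed

lemma valid_alg_behavioural:
  assumes "\<And>s n ps as x. f s n ps as x < m"
  shows "valid_alg m (behavioural P f)"
  using assms by (auto simp: valid_alg_def behavioural_def)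

lemma length_run_det [simp]: "length (run_det f n ps as xs) = length as + length xs"
  by (induction xs arbitrary: ps as) auto

lemma take_run_det: "take (length as) (run_det f n ps as xs) = as"
proof (induction xs arbitrary: ps as)
  case (Cons x xs)
  have "take (length as) (run_det f n ps as (x # xs)) =
    take (length as) (take (length (as @ [f n ps as x])) (run_det f n ps as (x # xs)))"
    by (simp add: min_def)
  then show ?case by (simp only: run_det.simps Cons.IH) simp
qed simp

text \<open>Reads each decision off the finished assignment, so that the analysis can work with one
  assignment instead of growing histories.\<close>

lemma nth_run_det:
  assumes "length as = length ps" "length as \<le> t" "t < length as + length xs"
  shows "run_det f n ps as xs ! t =
    f n (take t (ps @ xs)) (take t (run_det f n ps as xs)) ((ps @ xs) ! t)"
  using assms
proof (induction xs arbitrary: ps as)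
  case (Cons x xs)
  let ?r = "run_det f n ps as (x # xs)"
  show ?case
  proof (cases "t = length as")
    case True
    have "take (Suc t) ?r = as @ [f n ps as x]"
      using take_run_det[of "as @ [f n ps as x]" f n "ps @ [x]" xs] True by simp
    then have "?r ! t = f n ps as x" "take t ?r = as"
      using True take_run_det[of as f n ps "x # xs"] by (auto dest!: arg_cong[where f="\<lambda>l. l ! t"])
    then show ?thesis using True Cons.prems by (simp only:) (simp add: nth_append)
  next
    case False
    then show ?thesis
      using Cons.IH[of "as @ [f n ps as x]" "ps @ [x]"] Cons.prems by simp
  qed
qed simp

section \<open>Greedy assignment\<close>

definition partial_load :: "(nat \<Rightarrow> real) \<Rightarrow> (nat \<Rightarrow> nat) \<Rightarrow> nat \<Rightarrow> nat \<Rightarrow> real" where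
  "partial_load x a t j = (\<Sum>i<t. if a i = j then x i else 0)"

lemma load_take:
  assumes "t \<le> length xs" "length as = length xs"
  shows "load (take t xs) (take t as) = partial_load ((!) xs) ((!) as) t"
  using assms by (auto simp: load_def partial_load_def fun_eq_iff min_def intro!: sum.cong)

lemma partial_load_mono:
  assumes "\<And>t. t < N \<Longrightarrow> 0 \<le> x t" "s \<le> t" "t \<le> N"
  shows "partial_load x a s j \<le> partial_load x a t j"
  unfolding partial_load_def using assms by (intro sum_mono2) auto

lemma partial_load_ge:
  assumes "\<And>t. t < N \<Longrightarrow> 0 \<le> x t" "s < t" "t \<le> N"
  shows "x s \<le> partial_load x a t (a s)"
proof -
  have "x s \<le> partial_load x a s (a s) + x s"
    unfolding partial_load_def using assms by (auto intro!: sum_nonneg)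
  also have "\<dots> = partial_load x a (Suc s) (a s)" by (simp add: partial_load_def)
  also have "\<dots> \<le> partial_load x a t (a s)" by (rule partial_load_mono[OF assms(1)]) (use assms in auto)
  finally show ?thesis .
qed

text \<open>If machine \<open>j\<close> ended below \<tau>, every job of \<open>G\<close> would be
  put on a machine below \<tau> and lift it to at least \<tau>. Hence these jobs would go to
  distinct machines, and by counting one of them would go to \<open>j\<close>.\<close>

lemma greedy_covers_with_large_jobs:
  assumes nonneg: "\<And>t. t < N \<Longrightarrow> 0 \<le> x t"
    and G: "G \<subseteq> {..<N}" "\<And>t. t \<in> G \<Longrightarrow> \<tau> \<le> x t"
    and greedy: "\<And>t j. t \<in> G \<Longrightarrow> a t \<in> B \<and> (j \<in> B \<longrightarrow> partial_load x a t (a t) \<le> partial_load x a t j)"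
    and B: "finite B" "card B \<le> card G" and j: "j \<in> B"
  shows "\<tau> \<le> partial_load x a N j"
proof (rule ccontr)
  assume low: "\<not> ?thesis"
  have low_t: "partial_load x a t (a t) < \<tau>" if "t \<in> G" for t
    using greedy[OF that, of j] j low partial_load_mono[where x=x and N=N and s=t and t=N and a=a and j=j, OF nonneg] G(1) that by fastforce
  have ne: "a s \<noteq> a t" if "s \<in> G" "t \<in> G" "s < t" for s t
    using low_t[OF that(2)] partial_load_ge[where x=x and N=N and s=s and t=t and a=a, OF nonneg] G that by fastforce
  have inj: "inj_on a G"
    by (rule inj_onI) (metis ne linorder_neqE_nat)
  have "a ` G \<subseteq> B" using greedy by auto
  moreover have "card B \<le> card (a ` G)" using inj B by (simp add: card_image)
  ultimately have "a ` G = B" using B by (metis card_seteq)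
  then obtain t where "t \<in> G" "a t = j" using j by auto
  then show False using partial_load_ge[where x=x and N=N and s=t and t=N and a=a, OF nonneg] G low by fastforce
qed

text \<open>A job of \<open>G\<close> joins a machine only while that machine is no fuller than
  \<open>j\<close>. So the \<open>G\<close>-volume of any machine of \<open>S\<close> exceeds the
  load of \<open>j\<close> by at most \<tau>, and averaging over \<open>S\<close> gives the
  bound.\<close>

lemma greedy_covers_with_small_jobs:
  assumes nonneg: "\<And>t. t < N \<Longrightarrow> 0 \<le> x t"
    and G: "G \<subseteq> {..<N}" "\<And>t. t \<in> G \<Longrightarrow> x t \<le> \<tau>" and \<tau>: "0 \<le> \<tau>"
    and greedy: "\<And>t j. t \<in> G \<Longrightarrow> a t \<in> S \<and> (j \<in> S \<longrightarrow> partial_load x a t (a t) \<le> partial_load x a t j)"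
    and S: "finite S" and j: "j \<in> S"
  shows "(\<Sum>t\<in>G. x t) / card S - \<tau> \<le> partial_load x a N j"
proof -
  \<comment> \<open>Jobs outside \<open>G\<close> may also land in \<open>S\<close>. Only the volume
    of \<open>G\<close> is bounded from above, while \<open>j\<close> is measured by its full
    load.\<close>
  define s where "s t i = (\<Sum>k\<in>{..<t} \<inter> G. if a k = i then x k else 0)" for t i
  have s_le: "s t i \<le> partial_load x a t i" if "t \<le> N" for t i
    unfolding s_def partial_load_def using nonneg that by (intro sum_mono2) auto
  have s_Suc: "s (Suc t) i = s t i + (if t \<in> G \<and> a t = i then x t else 0)" for t i
  proof -
    have "{..<Suc t} \<inter> G = (if t \<in> G then insert t ({..<t} \<inter> G) else {..<t} \<inter> G)"
      by (auto simp: less_Suc_eq)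
    then show ?thesis by (auto simp: s_def)
  qed
  have inv: "s t i \<le> partial_load x a t j + \<tau>" if "t \<le> N" "i \<in> S" for t i
    using that
  proof (induction t)
    case 0
    then show ?case using \<tau> by (simp add: s_def partial_load_def)
  next
    case (Suc t)
    have mono: "partial_load x a t j \<le> partial_load x a (Suc t) j"
      by (rule partial_load_mono[OF nonneg]) (use Suc.prems in auto)
    show ?case
    proof (cases "t \<in> G \<and> a t = i")
      case True
      then have "s (Suc t) i \<le> partial_load x a t i + x t"
        using s_le[of t i] Suc.prems by (simp add: s_Suc)
      also have "\<dots> \<le> partial_load x a t j + \<tau>" using greedy[of t j] G(2)[of t] j True by auto
      finally show ?thesis using mono by simp
    qed (use Suc mono in \<open>auto simp: s_Suc\<close>)
  qed
  have "(\<Sum>t\<in>G. x t) = (\<Sum>t\<in>G. \<Sum>i\<in>S. if a t = i then x t else 0)"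
    using greedy S by (intro sum.cong) (auto simp: sum.delta')
  also have "\<dots> = (\<Sum>i\<in>S. s N i)"
    using G(1) by (subst sum.swap) (simp add: s_def Int_absorb1)
  also have "\<dots> \<le> (\<Sum>i\<in>S. partial_load x a N j + \<tau>)" by (intro sum_mono inv) auto
  finally have "(\<Sum>t\<in>G. x t) \<le> card S * (partial_load x a N j + \<tau>)" by simp
  moreover have "card S > 0" using S j by (auto simp: card_gt_0_iff)
  ultimately show ?thesis by (simp add: divide_le_eq algebra_simps)
qed

section \<open>Sampling without replacement\<close>

text \<open>The symmetric group is 2-transitive.\<close>

lemma ex_permutes_two_points:
  assumes "i \<in> S" "j \<in> S" "k \<in> S" "l \<in> S" "i \<noteq> j" "k \<noteq> l"
  obtains \<tau> where "\<tau> permutes S" "\<tau> k = i" "\<tau> l = j"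
proof -
  define \<tau> where "\<tau> = Transposition.transpose (Transposition.transpose k i l) j \<circ> Transposition.transpose k i"
  have l: "Transposition.transpose k i l \<in> S" using assms by (auto simp: Transposition.transpose_def)
  have "\<tau> permutes S"
    unfolding \<tau>_def by (intro permutes_compose permutes_swap_id) (use assms l in auto)
  moreover have "\<tau> k = i" "\<tau> l = j" using assms by (auto simp: \<tau>_def Transposition.transpose_def)
  ultimately show ?thesis using that by blast
qed

text \<open>By 2-transitivity the sum is the same for each of the \<open>n * (n - 1)\<close> ordered
  pairs of distinct positions. Summed over all pairs, each permutation contributes the square of the
  total minus the diagonal.\<close>

lemma sum_permutations_pair:
  fixes w :: "nat \<Rightarrow> real"
  assumes "i < n" "j < n" "i \<noteq> j"
  shows "real n * (real n - 1) * (\<Sum>\<sigma> | \<sigma> permutes {..<n}. w (\<sigma> i) * w (\<sigma> j)) =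
    fact n * ((\<Sum>k<n. w k)\<^sup>2 - (\<Sum>k<n. (w k)\<^sup>2))"
proof -
  let ?P = "{\<sigma>. \<sigma> permutes {..<n}}"
  have sym: "(\<Sum>\<sigma>\<in>?P. w (\<sigma> k) * w (\<sigma> l)) = (\<Sum>\<sigma>\<in>?P. w (\<sigma> i) * w (\<sigma> j))"
    if kl: "k < n" "l < n" "k \<noteq> l" for k l
  proof -
    obtain \<tau> where "\<tau> permutes {..<n}" "\<tau> k = i" "\<tau> l = j"
      by (rule ex_permutes_two_points[of i "{..<n}" j k l]) (use assms kl in auto)
    then show ?thesis
      using sum_permutations_compose_right[of \<tau> "{..<n}" "\<lambda>\<sigma>. w (\<sigma> k) * w (\<sigma> l)"] by simp
  qed
  let ?D = "{(k, l). k < n \<and> l < n \<and> k \<noteq> l}"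
  have D: "?D = {..<n} \<times> {..<n} - (\<lambda>k. (k, k)) ` {..<n}" by auto
  have inj: "inj_on (\<lambda>k. (k, k)) {..<n}" by (auto simp: inj_on_def)
  have "card ?D = n * n - n"
    unfolding D by (subst card_Diff_subset) (auto simp: card_image[OF inj])
  then have cD: "real (card ?D) = real n * (real n - 1)"
    by (simp add: of_nat_diff algebra_simps)
  have det: "(\<Sum>(k, l)\<in>?D. w (\<sigma> k) * w (\<sigma> l)) = (\<Sum>k<n. w k)\<^sup>2 - (\<Sum>k<n. (w k)\<^sup>2)"
    if "\<sigma> \<in> ?P" for \<sigma>
  proof -
    have bij: "(\<Sum>k<n. f (\<sigma> k)) = (\<Sum>k<n. f k)" for f :: "nat \<Rightarrow> real"
      using sum.permute[of \<sigma> "{..<n}" f] that by simp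
    have "(\<Sum>(k, l)\<in>?D. w (\<sigma> k) * w (\<sigma> l)) =
      (\<Sum>(k, l)\<in>{..<n} \<times> {..<n}. w (\<sigma> k) * w (\<sigma> l)) - (\<Sum>k<n. w (\<sigma> k) * w (\<sigma> k))"
      unfolding D by (subst sum_diff) (auto simp: sum.reindex[OF inj])
    also have "(\<Sum>(k, l)\<in>{..<n} \<times> {..<n}. w (\<sigma> k) * w (\<sigma> l)) = (\<Sum>k<n. w (\<sigma> k))\<^sup>2"
      by (simp add: sum.cartesian_product[symmetric] power2_eq_square sum_product)
    finally show ?thesis
      using bij[of w] bij[of "\<lambda>k. (w k)\<^sup>2"] by (simp add: power2_eq_square)
  qed
  have "real n * (real n - 1) * (\<Sum>\<sigma>\<in>?P. w (\<sigma> i) * w (\<sigma> j)) =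
    (\<Sum>(k, l)\<in>?D. \<Sum>\<sigma>\<in>?P. w (\<sigma> k) * w (\<sigma> l))"
    using sym by (simp add: cD[symmetric] case_prod_beta)
  also have "\<dots> = (\<Sum>\<sigma>\<in>?P. \<Sum>(k, l)\<in>?D. w (\<sigma> k) * w (\<sigma> l))"
    unfolding case_prod_beta by (rule sum.swap)
  also have "\<dots> = (\<Sum>\<sigma>\<in>?P. (\<Sum>k<n. w k)\<^sup>2 - (\<Sum>k<n. (w k)\<^sup>2))"
    by (intro sum.cong refl det)
  also have "\<dots> = fact n * ((\<Sum>k<n. w k)\<^sup>2 - (\<Sum>k<n. (w k)\<^sup>2))"
    by (simp add: card_permutations[of "{..<n}" n])
  finally show ?thesis .
qed

lemma sum_permutations_single:
  fixes w :: "nat \<Rightarrow> real"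
  assumes "i < n"
  shows "real n * (\<Sum>\<sigma> | \<sigma> permutes {..<n}. w (\<sigma> i)) = fact n * (\<Sum>k<n. w k)"
proof -
  let ?P = "{\<sigma>. \<sigma> permutes {..<n}}"
  have sym: "(\<Sum>\<sigma>\<in>?P. w (\<sigma> k)) = (\<Sum>\<sigma>\<in>?P. w (\<sigma> i))" if "k < n" for k
    using sum_permutations_compose_right[of "Transposition.transpose k i" "{..<n}" "\<lambda>\<sigma>. w (\<sigma> k)"] assms that
    by (simp add: permutes_swap_id)
  have "real n * (\<Sum>\<sigma>\<in>?P. w (\<sigma> i)) = (\<Sum>k<n. \<Sum>\<sigma>\<in>?P. w (\<sigma> k))" using sym by simp
  also have "\<dots> = (\<Sum>\<sigma>\<in>?P. \<Sum>k<n. w (\<sigma> k))" by (rule sum.swap)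
  also have "\<dots> = (\<Sum>\<sigma>\<in>?P. \<Sum>k<n. w k)"
    by (rule sum.cong[OF refl]) (use sum.permute[of _ "{..<n}" w] in \<open>simp add: o_def\<close>)
  finally show ?thesis by (simp add: card_permutations[of "{..<n}" n])
qed

text \<open>After expanding the square, the squared total enters with coefficient
  \<open>h * (h - 1) / (n * (n - 1)) - (h / n)\<^sup>2\<close>, which is at most 0 for a sample
  without replacement, so only the sum of squares remains.\<close>

lemma sample_variance_le:
  fixes w :: "nat \<Rightarrow> real" and h n :: nat
  assumes "h \<le> n"
  shows "(\<Sum>\<sigma> | \<sigma> permutes {..<n}. ((\<Sum>i<h. w (\<sigma> i)) - h / n * (\<Sum>k<n. w k))\<^sup>2)
    \<le> fact n * (h / n * (\<Sum>k<n. (w k)\<^sup>2))"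
proof (cases "n \<le> 1")
  \<comment> \<open>The expansion divides by \<open>n - 1\<close>, so \<open>n \<le> 1\<close> is
    treated apart.\<close>
  case True
  then consider "n = 0" | "n = 1" "h = 0" | "n = 1" "h = 1" using assms by fastforce
  then show ?thesis
  proof cases
    case 3
    have "{\<sigma>. \<sigma> permutes {..<1::nat}} = {id}" by (auto simp: lessThan_Suc)
    then show ?thesis using 3 by simp
  qed (use assms in \<open>auto\<close>)
next
  case False
  let ?P = "{\<sigma>. \<sigma> permutes {..<n}}"
  define W1 W2 where "W1 = (\<Sum>k<n. w k)" and "W2 = (\<Sum>k<n. (w k)\<^sup>2)"
  have n: "real n > 0" "real n - 1 > 0" using False by auto
  have W2: "0 \<le> W2" by (simp add: W2_def sum_nonneg)
  have single: "(\<Sum>\<sigma>\<in>?P. w (\<sigma> i)) = fact n * W1 / n" 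
     "(\<Sum>\<sigma>\<in>?P. w (\<sigma> i) * w (\<sigma> i)) = fact n * W2 / n" if "i < h" for i
    using sum_permutations_single[of i n w] sum_permutations_single[of i n "\<lambda>k. (w k)\<^sup>2"] that assms n
    by (auto simp: W1_def W2_def field_simps power2_eq_square)
  have pair: "(\<Sum>\<sigma>\<in>?P. w (\<sigma> i) * w (\<sigma> j)) = fact n * (W1\<^sup>2 - W2) / (n * (real n - 1))"
    if "i < h" "j < h" "i \<noteq> j" for i j
    using sum_permutations_pair[of i n j w] that assms n by (simp add: W1_def W2_def eq_divide_eq mult_ac)
  have "(\<Sum>\<sigma>\<in>?P. (\<Sum>i<h. w (\<sigma> i))\<^sup>2) = (\<Sum>i<h. \<Sum>j<h. \<Sum>\<sigma>\<in>?P. w (\<sigma> i) * w (\<sigma> j))"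
    unfolding power2_eq_square sum_product
    by (subst sum.swap, intro sum.cong refl) (subst sum.swap, rule refl)
  also have "\<dots> = (\<Sum>i<h. \<Sum>j<h. if j = i then fact n * W2 / n else fact n * (W1\<^sup>2 - W2) / (n * (real n - 1)))"
    by (intro sum.cong refl) (auto simp: single pair)
  also have "\<dots> = h * (fact n * W2 / n) + h * (real h - 1) * (fact n * (W1\<^sup>2 - W2) / (n * (real n - 1)))"
  proof -
    have "(\<Sum>j<h. if j = i then a else b) = a + (real h - 1) * b" if "i < h" for i and a b :: real
    proof -
      have "(\<Sum>j<h. if j = i then a else b) = (\<Sum>j<h. b + (if j = i then a - b else 0))"
        by (intro sum.cong) auto
      also have "\<dots> = h * b + (a - b)" using that by (simp add: sum.distrib)
      finally show ?thesis by (simp add: algebra_simps)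
    qed
    then show ?thesis by (simp add: distrib_left mult.assoc)
  qed
  finally have sq: "(\<Sum>\<sigma>\<in>?P. (\<Sum>i<h. w (\<sigma> i))\<^sup>2) = \<dots>" .
  have lin: "(\<Sum>\<sigma>\<in>?P. \<Sum>i<h. w (\<sigma> i)) = h * (fact n * W1 / n)"
    by (subst sum.swap) (simp add: single)
  have "(\<Sum>\<sigma>\<in>?P. ((\<Sum>i<h. w (\<sigma> i)) - h / n * W1)\<^sup>2) =
    (\<Sum>\<sigma>\<in>?P. (\<Sum>i<h. w (\<sigma> i))\<^sup>2) - 2 * (h / n * W1) * (\<Sum>\<sigma>\<in>?P. \<Sum>i<h. w (\<sigma> i))
      + fact n * (h / n * W1)\<^sup>2"
    by (simp add: power2_diff sum.distrib sum_subtractf sum_distrib_left sum_distrib_right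
        sum_divide_distrib card_permutations[of "{..<n}" n] mult_ac)
  also have "\<dots> = fact n * (h / n * W2 - h * (real h - 1) / (n * (real n - 1)) * W2
      + (h * (real h - 1) / (n * (real n - 1)) - (h / n)\<^sup>2) * W1\<^sup>2)"
    unfolding sq lin by (simp add: algebra_simps power2_eq_square diff_divide_distrib add_divide_distrib)
  also have "\<dots> \<le> fact n * (h / n * W2)"
  proof -
    have "0 \<le> h * (real h - 1)" by (cases h) auto
    then have a: "0 \<le> h * (real h - 1) / (n * (real n - 1)) * W2" using n W2 by simp
    have "(real h - 1) / (real n - 1) \<le> h / n" using n assms by (simp add: field_simps)
    then have "h / n * ((real h - 1) / (real n - 1)) \<le> h / n * (h / n)"
      by (intro mult_left_mono) auto
    then have b: "h * (real h - 1) / (n * (real n - 1)) - (h / n)\<^sup>2 \<le> 0"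
      by (simp add: power2_eq_square)
    have "(h * (real h - 1) / (n * (real n - 1)) - (h / n)\<^sup>2) * W1\<^sup>2 \<le> 0"
      using b by (intro mult_nonpos_nonneg) auto
    with a show ?thesis by (intro mult_left_mono) auto
  qed
  finally show ?thesis unfolding W1_def W2_def .
qed

text \<open>Chebyshev's inequality, scaled by \<open>fact n\<close> so that it counts
  permutations.\<close>

lemma card_sample_deviation_le:
  fixes w :: "nat \<Rightarrow> real" and h n :: nat and \<delta> :: real
  assumes "h \<le> n" "0 < \<delta>"
  shows "card {\<sigma>. \<sigma> permutes {..<n} \<and> \<delta> \<le> \<bar>(\<Sum>i<h. w (\<sigma> i)) - h / n * (\<Sum>k<n. w k)\<bar>} * \<delta>\<^sup>2
    \<le> fact n * (h / n * (\<Sum>k<n. (w k)\<^sup>2))"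
proof -
  let ?X = "\<lambda>\<sigma>. (\<Sum>i<h. w (\<sigma> i)) - h / n * (\<Sum>k<n. w k)"
  let ?A = "{\<sigma>. \<sigma> permutes {..<n} \<and> \<delta> \<le> \<bar>?X \<sigma>\<bar>}"
  have fin: "finite {\<sigma>. \<sigma> permutes {..<n}}" by (simp add: finite_permutations)
  have "card ?A * \<delta>\<^sup>2 = (\<Sum>\<sigma>\<in>?A. \<delta>\<^sup>2)" by simp
  also have "\<dots> \<le> (\<Sum>\<sigma>\<in>?A. (?X \<sigma>)\<^sup>2)"
    using assms by (intro sum_mono) (auto simp: abs_le_square_iff[symmetric])
  also have "\<dots> \<le> (\<Sum>\<sigma> | \<sigma> permutes {..<n}. (?X \<sigma>)\<^sup>2)"
    by (rule sum_mono2[OF fin]) auto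
  finally show ?thesis using sample_variance_le[OF assms(1), of w] by linarith
qed

section \<open>The optimum and the algorithm\<close>

definition count_ge :: "real list \<Rightarrow> real \<Rightarrow> nat" where
  "count_ge ps x = card {i. i < length ps \<and> x \<le> ps ! i}"

definition vol_lt :: "real list \<Rightarrow> real \<Rightarrow> real" where
  "vol_lt ps x = (\<Sum>i | i < length ps \<and> ps ! i < x. ps ! i)"

lemma count_ge_antimono: "x \<le> y \<Longrightarrow> count_ge ps y \<le> count_ge ps x"
  unfolding count_ge_def by (intro card_mono) auto

lemma vol_lt_mono:
  assumes "\<forall>x\<in>set ps. 0 \<le> x" "x \<le> y"
  shows "vol_lt ps x \<le> vol_lt ps y"
  unfolding vol_lt_def using assms by (intro sum_mono2) auto

lemma min_load_nonneg:
  assumes "\<forall>x\<in>set ps. 0 \<le> x" "m > 0"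
  shows "0 \<le> min_load m ps as"
  unfolding min_load_def using assms by (intro Min.boundedI) (auto simp: load_def intro!: sum_nonneg)

lemma OPT_attained:
  assumes "m > 0"
  obtains as where "length as = length ps" "set as \<subseteq> {..<m}" "OPT m ps = min_load m ps as"
proof -
  let ?A = "{as. length as = length ps \<and> set as \<subseteq> {..<m}}"
  have "finite ?A" using finite_lists_length_eq[of "{..<m}" "length ps"] by (simp add: conj_commute)
  moreover have "replicate (length ps) 0 \<in> ?A" using assms by auto
  ultimately have "OPT m ps \<in> min_load m ps ` ?A"
    unfolding OPT_def by (intro Max_in) blast+
  then show ?thesis using that by auto
qed

lemma OPT_nonneg:
  assumes "\<forall>x\<in>set ps. 0 \<le> x" "m > 0"
  shows "0 \<le> OPT m ps"
proof -
  obtain as where "OPT m ps = min_load m ps as" using OPT_attained[OF assms(2)] by metis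
  then show ?thesis using min_load_nonneg[OF assms] by simp
qed

text \<open>In an optimal assignment the jobs of size at least \<open>x\<close> occupy at most
  \<open>count_ge ps x\<close> machines. Every other machine reaches the optimum with jobs below
  \<open>x\<close> alone. The difference is taken in the reals and may be negative.\<close>

lemma OPT_volume_bound:
  assumes nn: "\<forall>x\<in>set ps. 0 \<le> x" and m: "m > 0"
  shows "OPT m ps * (real m - count_ge ps x) \<le> vol_lt ps x"
proof -
  obtain as where as: "length as = length ps" "set as \<subseteq> {..<m}" "OPT m ps = min_load m ps as"
    using OPT_attained[OF m] .
  let ?I = "{i. i < length ps}"
  let ?L = "{i. i < length ps \<and> x \<le> ps ! i}"
  define E where "E = {..<m} - (\<lambda>i. as ! i) ` ?L"
  have fin: "finite E" by (simp add: E_def)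
  have "m - card ?L \<le> m - card ((\<lambda>i. as ! i) ` ?L)"
    by (intro diff_le_mono2 card_image_le) simp
  also have "\<dots> \<le> card E" 
    using diff_card_le_card_Diff[of "(!) as ` ?L" "{..<m}"] by (simp add: E_def)
  finally have cE: "real m - count_ge ps x \<le> card E" by (simp add: count_ge_def)
  have "OPT m ps * (real m - count_ge ps x) \<le> OPT m ps * card E"
    using OPT_nonneg[OF nn m] cE by (rule mult_left_mono[rotated])
  also have "\<dots> = (\<Sum>j\<in>E. OPT m ps)" by simp
  also have "\<dots> \<le> (\<Sum>j\<in>E. load ps as j)"
    unfolding as(3) min_load_def by (intro sum_mono Min_le) (auto simp: E_def)
  also have "\<dots> = (\<Sum>i\<in>?I. \<Sum>j\<in>E. if as ! i = j then ps ! i else 0)"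
    unfolding load_def lessThan_def by (rule sum.swap)
  also have "\<dots> = (\<Sum>i\<in>?I. if as ! i \<in> E then ps ! i else 0)"
    using fin by (simp add: sum.delta')
  also have "\<dots> = (\<Sum>i\<in>{i\<in>?I. as ! i \<in> E}. ps ! i)"
    by (rule sum.inter_filter[symmetric]) simp
  also have "\<dots> \<le> vol_lt ps x"
    unfolding vol_lt_def
  proof (rule sum_mono2)
    show "{i \<in> ?I. as ! i \<in> E} \<subseteq> {i. i < length ps \<and> ps ! i < x}"
      using not_le by (auto simp: E_def)
  qed (use nn in auto)
  finally show ?thesis .
qed

text \<open>The scale is found by doubling, starting from OPT/8, until the lower bound on the volume fails;
  the failure at the next scale yields the upper bound.\<close>

lemma ex_scale:
  assumes nn: "\<forall>x\<in>set ps. 0 \<le> x" and m: "m > 0" and pos: "OPT m ps > 0"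
  obtains y where "OPT m ps / 8 \<le> y" "8 * y * (real m - count_ge ps y) \<le> vol_lt ps y"
    "vol_lt ps y \<le> 16 * y * m"
proof -
  define x where "x i = OPT m ps / 8 * 2 ^ i" for i :: nat
  define F where "F i \<longleftrightarrow> 8 * x i * (real m - count_ge ps (x i)) \<le> vol_lt ps (x i)" for i
  have x_pos: "x i > 0" for i using pos by (simp add: x_def)
  \<comment> \<open>At \<open>OPT m ps / 8\<close> the factor 8 cancels and the condition is
    \<open>OPT_volume_bound\<close>.\<close>
  have F0: "F 0" using OPT_volume_bound[OF nn m, of "x 0"] by (simp add: F_def x_def)
  \<comment> \<open>Once \<open>x k\<close> exceeds the total size, no job reaches
    \<open>x k\<close>, and the condition would ask for a volume of at least
    \<open>8 * x k * m\<close>.\<close>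
  obtain k where k: "sum_list ps * 8 / OPT m ps < 2 ^ k"
    using real_arch_pow[of 2] by auto
  then have xk: "sum_list ps < x k" using pos by (simp add: x_def field_simps)
  have small: "ps ! i < x k" if "i < length ps" for i
    using member_le_sum_list[of "ps ! i" ps] that nn xk by simp
  then have "count_ge ps (x k) = 0" by (force simp: count_ge_def)
  moreover have "vol_lt ps (x k) = sum_list ps"
    using small unfolding vol_lt_def sum_list_sum_nth by (intro sum.cong) auto
  moreover have "x k * 1 \<le> x k * (8 * real m)" using m x_pos[of k] by (intro mult_left_mono) auto
  ultimately have "\<not> F k" using xk by (simp add: F_def)
  then obtain i where i: "F i" "\<not> F (Suc i)"
    using F0 nat_induct[of F k] by blast
  have "vol_lt ps (x i) \<le> vol_lt ps (x (Suc i))"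
    by (rule vol_lt_mono[OF nn]) (use pos in \<open>simp add: x_def\<close>)
  also have "\<dots> \<le> 8 * x (Suc i) * (real m - count_ge ps (x (Suc i)))" using i(2) by (simp add: F_def)
  also have "\<dots> \<le> 8 * x (Suc i) * m"
    using x_pos[of "Suc i"] by (intro mult_left_mono) auto
  finally have "vol_lt ps (x i) \<le> 16 * x i * m" by (simp add: x_def)
  moreover have "OPT m ps / 8 \<le> x i" using pos by (simp add: x_def)
  ultimately show ?thesis using that i(1) by (auto simp: F_def)
qed

text \<open>The entry of rank r, counted from 0, in decreasing order. For r at least the length of the list
  this is the maximum of the empty set.\<close>

definition quantile :: "real list \<Rightarrow> nat \<Rightarrow> real" where
  "quantile xs r = Max {v \<in> set xs. r < count_ge xs v}"

text \<open>\<open>C\<close> provides more than \<open>r\<close> positions with entries at least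
  \<gamma>, and at most \<open>r\<close> positions, those in \<open>A\<close>, can exceed \<beta>.
  \<open>C\<close> also makes the set under the maximum nonempty.\<close>

lemma quantile_bounds:
  assumes C: "C \<subseteq> {..<length xs}" "r < card C" "\<And>i. i \<in> C \<Longrightarrow> \<gamma> \<le> xs ! i"
    and A: "A \<subseteq> {..<length xs}" "card A \<le> r" "\<And>i. i < length xs \<Longrightarrow> i \<notin> A \<Longrightarrow> xs ! i \<le> \<beta>"
  shows "\<gamma> \<le> quantile xs r" "quantile xs r \<le> \<beta>"
proof -
  let ?Q = "{v \<in> set xs. r < count_ge xs v}"
  have finC: "finite C" using C(1) finite_subset by blast
  have "C \<noteq> {}" using C(2) by auto
  define v where "v = Min ((!) xs ` C)"
  have v: "v \<in> (!) xs ` C" unfolding v_def using finC \<open>C \<noteq> {}\<close> by (intro Min_in) auto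
  have "card C \<le> count_ge xs v"
    unfolding count_ge_def using C(1) finC by (intro card_mono) (auto simp: v_def)
  then have vQ: "v \<in> ?Q" using v C by auto
  have "\<gamma> \<le> v" using v C(3) by auto
  also have "v \<le> quantile xs r" unfolding quantile_def using vQ by (intro Max_ge) auto
  finally show "\<gamma> \<le> quantile xs r" .
  have "quantile xs r \<in> ?Q" unfolding quantile_def by (rule Max_in) (use vQ in auto)
  then have "card A < card {i. i < length xs \<and> quantile xs r \<le> xs ! i}"
    using A(2) by (simp add: count_ge_def)
  moreover have "finite A" using A(1) finite_subset by blast
  ultimately have "\<not> {i. i < length xs \<and> quantile xs r \<le> xs ! i} \<subseteq> A"
    using card_mono[of A] by (metis leD)
  then show "quantile xs r \<le> \<beta>" using A(3) by force
qed

text \<open>Applied to the sample, this is the volume V of the outline. The comparison is not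
  strict, so jobs tied with the quantile count; the lower bound on V relies on this.\<close>

definition sample_vol :: "real list \<Rightarrow> nat \<Rightarrow> real" where
  "sample_vol xs r = (\<Sum>i | i < length xs \<and> xs ! i \<le> quantile xs r. xs ! i)"

text \<open>With e = 0 no job is small, and the algorithm below is the greedy strategy on all machines.\<close>

definition small_job :: "nat \<Rightarrow> nat \<Rightarrow> nat \<Rightarrow> nat \<Rightarrow> real list \<Rightarrow> real \<Rightarrow> bool" where
  "small_job e l r n ps x \<longleftrightarrow>
     0 < e \<and> n div 2 \<le> length ps \<and> x < sample_vol (take (n div 2) ps) r / 2 ^ l"

text \<open>The machines below e are reserved for the small jobs. If e is at least m, machine m - 1 serves
  both kinds of jobs, so that neither set of machines is empty.\<close>

definition cover_alg :: "nat \<Rightarrow> nat \<Rightarrow> nat \<Rightarrow> nat \<Rightarrow> det_alg" where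
  "cover_alg m e l r n ps as x =
     arg_min_on (load ps as) (if small_job e l r n ps x then {..<min e m} else {min e (m - 1)..<m})"

lemma cover_alg_less:
  assumes "m > 0"
  shows "cover_alg m e l r n ps as x < m"
proof -
  let ?S = "if small_job e l r n ps x then {..<min e m} else {min e (m - 1)..<m}"
  have "?S \<noteq> {}" using assms by (auto simp: small_job_def)
  then have "cover_alg m e l r n ps as x \<in> ?S"
    unfolding cover_alg_def by (intro arg_min_if_finite(1)) auto
  then show ?thesis by (auto split: if_splits)
qed

section \<open>Load guarantees on a fixed order\<close>

context
  fixes m e l r :: nat and xs :: "real list" and as :: "nat list"
  assumes m: "m > 0" and nn: "\<forall>x\<in>set xs. 0 \<le> x"
  defines "as \<equiv> run_det (cover_alg m e l r) (length xs) [] [] xs"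
begin

lemma len_as: "length as = length xs" by (simp add: as_def)

lemma cover_alg_step:
  assumes "t < length xs"
    and "S = (if small_job e l r (length xs) (take t xs) (xs ! t) then {..<min e m} else {min e (m - 1)..<m})"
  shows "as ! t \<in> S \<and>
    (j \<in> S \<longrightarrow> partial_load ((!) xs) ((!) as) t (as ! t) \<le> partial_load ((!) xs) ((!) as) t j)"
proof -
  have "as ! t = arg_min_on (load (take t xs) (take t as)) S"
    using nth_run_det[of "[]" "[]" t xs "cover_alg m e l r" "length xs"] assms
    by (simp add: as_def[symmetric] cover_alg_def)
  then have a: "as ! t = arg_min_on (partial_load ((!) xs) ((!) as) t) S"
    using load_take[of t xs as] len_as assms by simp
  have "finite S" "S \<noteq> {}" using assms(2) m by (auto simp: small_job_def)
  then show ?thesis unfolding a by (simp add: arg_min_if_finite(1) arg_min_least)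
qed

lemma load_as: "load xs as = partial_load ((!) xs) ((!) as) (length xs)"
  using load_take[of "length xs" xs as] len_as by simp

text \<open>Jobs of size at least \<tau> are never treated as small, so all of them go to the
  machines from \<open>min e (m - 1)\<close> on, and there are enough of them for
  \<open>greedy_covers_with_large_jobs\<close>.\<close>

lemma cover_alg_large:
  assumes T: "\<And>t. t < length xs \<Longrightarrow> \<tau> \<le> xs ! t \<Longrightarrow> \<not> small_job e l r (length xs) (take t xs) (xs ! t)"
    and card: "m - min e (m - 1) \<le> count_ge xs \<tau>" and j: "min e (m - 1) \<le> j" "j < m"
  shows "\<tau> \<le> load xs as j"
  unfolding load_as
proof (rule greedy_covers_with_large_jobs[where G = "{t. t < length xs \<and> \<tau> \<le> xs ! t}"
      and B = "{min e (m - 1)..<m}"])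
  show "as ! t \<in> {min e (m - 1)..<m} \<and> (j \<in> {min e (m - 1)..<m} \<longrightarrow>
      partial_load ((!) xs) ((!) as) t (as ! t) \<le> partial_load ((!) xs) ((!) as) t j)"
    if "t \<in> {t. t < length xs \<and> \<tau> \<le> xs ! t}" for t j
    by (rule cover_alg_step) (use that T in auto)
  show "card {min e (m - 1)..<m} \<le> card {t. t < length xs \<and> \<tau> \<le> xs ! t}"
    using card by (simp add: count_ge_def)
qed (use j nn in auto)

text \<open>The sum starts at the second half because no job of the sample is ever treated as
  small.\<close>

lemma cover_alg_small:
  fixes T :: real
  assumes T_def: "T = sample_vol (take (length xs div 2) xs) r / 2 ^ l"
    and e: "e > 0" and T: "T \<ge> 0" and j: "j < min e m"
  shows "(\<Sum>t | length xs div 2 \<le> t \<and> t < length xs \<and> xs ! t < T. xs ! t) / min e m - T \<le> load xs as j"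
proof -
  let ?G = "{t. length xs div 2 \<le> t \<and> t < length xs \<and> xs ! t < T}"
  have "(\<Sum>t\<in>?G. xs ! t) / card {..<min e m} - T \<le> partial_load ((!) xs) ((!) as) (length xs) j"
  proof (rule greedy_covers_with_small_jobs)
    show "as ! t \<in> {..<min e m} \<and> (j \<in> {..<min e m} \<longrightarrow>
        partial_load ((!) xs) ((!) as) t (as ! t) \<le> partial_load ((!) xs) ((!) as) t j)"
      if "t \<in> ?G" for t j
      by (rule cover_alg_step) (use that e in \<open>auto simp: small_job_def T_def min_def\<close>)
  qed (use nn T j in auto)
  then show ?thesis by (simp add: load_as)
qed

lemma greedy_min_load:
  assumes "e = 0" "m \<le> count_ge xs \<tau>"
  shows "\<tau> \<le> min_load m xs as"
proof -
  have "\<tau> \<le> load xs as j" if "j < m" for j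
    by (rule cover_alg_large) (use assms that in \<open>simp_all add: small_job_def\<close>)
  then show ?thesis unfolding min_load_def using m by (intro Min.boundedI) auto
qed

text \<open>The reserved machines are filled by volume, using \<open>small\<close>. For the others,
  \<open>large\<close> supplies at least as many jobs of size at least \<open>T\<close> as there are
  machines.\<close>

lemma cover_alg_min_load:
  fixes T \<beta> :: real
  assumes T_def: "T = sample_vol (take (length xs div 2) xs) r / 2 ^ l"
    and e: "e > 0" and T: "T \<ge> 0" "\<beta> \<le> T" and large: "m \<le> e + count_ge xs T"
    and small: "e * (\<beta> + T) \<le> (\<Sum>t | length xs div 2 \<le> t \<and> t < length xs \<and> xs ! t < T. xs ! t)"
  shows "\<beta> \<le> min_load m xs as"
proof -
  have "\<beta> \<le> load xs as j" if "j < m" for j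
  proof (cases "j < min e m")
    case True
    let ?V = "\<Sum>t | length xs div 2 \<le> t \<and> t < length xs \<and> xs ! t < T. xs ! t"
    have "0 \<le> ?V" using nn by (intro sum_nonneg) auto
    then have "?V / e \<le> ?V / min e m" using e m by (intro divide_left_mono) auto
    moreover have "\<beta> + T \<le> ?V / e" using small e by (simp add: field_simps)
    ultimately show ?thesis using cover_alg_small[OF T_def e T(1), of j] True by linarith
  next
    \<comment> \<open>Here \<open>e \<le> j\<close> and \<open>j < m\<close>, so the two groups of
      machines are disjoint.\<close>
    case False
    then have e_m: "min e (m - 1) = e" "e \<le> j" using that by auto
    have "T \<le> load xs as j"
      by (rule cover_alg_large) (use e_m that large in \<open>simp_all add: T_def small_job_def\<close>)
    with T show ?thesis by simp
  qed
  then show ?thesis unfolding min_load_def using m by (intro Min.boundedI) auto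
qed

end

section \<open>Orders with a representative sample\<close>

text \<open>Ties are broken by choosing a set, so its size is exactly \<open>k\<close>, which a
  threshold on the values could not ensure.\<close>

lemma ex_top_set:
  fixes f :: "'a \<Rightarrow> real"
  assumes "finite A" "k \<le> card A"
  obtains M where "M \<subseteq> A" "card M = k" "\<And>i j. i \<in> M \<Longrightarrow> j \<in> A - M \<Longrightarrow> f j \<le> f i"
proof -
  have "\<exists>M\<subseteq>A. card M = k \<and> (\<forall>i\<in>M. \<forall>j\<in>A - M. f j \<le> f i)"
    using assms(2)
  proof (induction k)
    case 0
    show ?case by (intro exI[of _ "{}"]) auto
  next
    case (Suc k)
    then obtain M where M: "M \<subseteq> A" "card M = k" "\<forall>i\<in>M. \<forall>j\<in>A - M. f j \<le> f i" by auto
    have fin: "finite M" "finite (A - M)" using M(1) assms(1) finite_subset by auto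
    have "A - M \<noteq> {}" using M Suc.prems card_mono[OF fin(1)] by fastforce
    then have "Max (f ` (A - M)) \<in> f ` (A - M)" using fin(2) by (intro Max_in) auto
    then obtain a where a: "a \<in> A - M" "f a = Max (f ` (A - M))" by auto
    then have a_max: "f j \<le> f a" if "j \<in> A - M" for j using fin(2) that by simp
    have "f j \<le> f i" if "i \<in> insert a M" "j \<in> A - insert a M" for i j
      using that a_max M(3) by auto
    then show ?case
      by (intro exI[of _ "insert a M"]) (use M(1,2) a(1) fin(1) in auto)
  qed
  then show ?thesis using that by blast
qed

text \<open>\<open>M\<close> holds the \<open>m\<close> largest jobs and \<open>W\<close>, the
  window, the next \<open>8 * q\<close>. As fewer than \<open>m\<close> jobs reach
  \<open>y / (8 * q)\<close>, all jobs outside \<open>M\<close> stay below it. With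
  \<open>d = m - count_ge ps y\<close>, the jobs below \<open>y\<close> have volume at least
  \<open>8 * y * d\<close>. Of this \<open>M\<close> takes at most \<open>y * d\<close> and
  \<open>W\<close> at most \<open>y \<le> y * d\<close>, so \<open>6 * y * d\<close> is
  left.\<close>

lemma ex_window:
  fixes ps :: "real list" and y :: real and m q :: nat
  assumes nn: "\<forall>x\<in>set ps. 0 \<le> x" and y: "y > 0" and q: "q > 0"
    and few: "count_ge ps (y / (8 * q)) < m"
    and vol: "8 * y * (real m - count_ge ps y) \<le> vol_lt ps y"
  obtains M W where "M \<subseteq> {..<length ps}" "W \<subseteq> {..<length ps} - M" "card M = m" "card W = 8 * q"
    "\<And>i. i < length ps \<Longrightarrow> i \<notin> M \<Longrightarrow> ps ! i < y / (8 * q)"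
    "\<And>i z. i \<in> M \<union> W \<Longrightarrow> z \<in> {..<length ps} - M - W \<Longrightarrow> ps ! z \<le> ps ! i"
    "6 * y * (real m - count_ge ps y) \<le> (\<Sum>z\<in>{..<length ps} - M - W. ps ! z)"
proof -
  let ?n = "length ps"
  let ?c = "y / (8 * q)"
  \<comment> \<open>The list might still be too short for full sizes of \<open>M\<close> and
    \<open>W\<close>. The minima disappear once the remaining set turns out to be nonempty.\<close>
  obtain M where M: "M \<subseteq> {..<?n}" "card M = min m ?n"
      "\<And>i j. i \<in> M \<Longrightarrow> j \<in> {..<?n} - M \<Longrightarrow> ps ! j \<le> ps ! i"
    using ex_top_set[of "{..<?n}" "min m ?n" "(!) ps"] by auto
  obtain W where W: "W \<subseteq> {..<?n} - M" "card W = min (8 * q) (card ({..<?n} - M))"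
      "\<And>i j. i \<in> W \<Longrightarrow> j \<in> {..<?n} - M - W \<Longrightarrow> ps ! j \<le> ps ! i"
    using ex_top_set[of "{..<?n} - M" "min (8 * q) (card ({..<?n} - M))" "(!) ps"] by auto
  let ?Z = "{..<?n} - M - W"
  have finM: "finite M" and finW: "finite W" by (meson M(1) W(1) finite_Diff finite_lessThan finite_subset)+
  have cM: "card M = m" if "i < ?n" "i \<notin> M" for i
  proof -
    have "card M < card {..<?n}" using M(1) that by (intro psubset_card_mono) auto
    then show ?thesis using M(2) by auto
  qed
  have out: "ps ! i < ?c" if "i < ?n" "i \<notin> M" for i
  proof (rule ccontr)
    assume "\<not> ?thesis"
    then have "M \<subseteq> {i. i < ?n \<and> ?c \<le> ps ! i}"
      using M(1) M(3)[of _ i] that by (force simp: not_less)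
    then have "card M \<le> count_ge ps ?c" unfolding count_ge_def by (intro card_mono) auto
    then show False using few cM[OF that] by simp
  qed
  have c_le: "?c \<le> y" using y q by (simp add: field_simps)
  have d: "1 \<le> real m - count_ge ps y"
  proof -
    have "count_ge ps y \<le> count_ge ps ?c"
      using c_le by (rule count_ge_antimono)
    then show ?thesis using few by linarith
  qed
  let ?L = "{i. i < ?n \<and> y \<le> ps ! i}"
  have L: "?L \<subseteq> M" using out c_le by force
  have "card (M - ?L) = card M - count_ge ps y"
    unfolding count_ge_def using L by (intro card_Diff_subset) (auto intro: finite_subset[OF _ finM])
  then have cML: "real (card (M - ?L)) \<le> real m - count_ge ps y"
    using M(2) d by simp
  have "vol_lt ps y \<le> (\<Sum>i\<in>(M - ?L) \<union> W \<union> ?Z. ps ! i)"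
    unfolding vol_lt_def
  proof (rule sum_mono2)
    show "{i. i < ?n \<and> ps ! i < y} \<subseteq> (M - ?L) \<union> W \<union> ?Z" by auto
    show "0 \<le> ps ! i" if "i \<in> (M - ?L) \<union> W \<union> ?Z - {i. i < ?n \<and> ps ! i < y}" for i
    proof -
      have "i < ?n" using that M(1) W(1) by blast
      then show ?thesis using nn by simp
    qed
  qed (use finM finW in auto)
  also have "\<dots> = (\<Sum>i\<in>M - ?L. ps ! i) + (\<Sum>i\<in>W. ps ! i) + (\<Sum>i\<in>?Z. ps ! i)"
  proof -
    have "(M - ?L) \<inter> W = {}" "(M - ?L \<union> W) \<inter> ?Z = {}" using W(1) by blast+
    then show ?thesis using finM finW by (simp add: sum.union_disjoint)
  qed
  also have "(\<Sum>i\<in>M - ?L. ps ! i) \<le> card (M - ?L) * y"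
    using M(1) by (intro sum_bounded_above) (auto simp: not_le)
  also have "\<dots> \<le> (real m - count_ge ps y) * y"
    using cML y by (intro mult_right_mono) auto
  also have "(\<Sum>i\<in>W. ps ! i) \<le> card W * ?c"
    using out W(1) by (intro sum_bounded_above less_imp_le) auto
  also have "\<dots> \<le> (8 * q) * ?c" using W(2) y by (intro mult_right_mono) auto
  also have "\<dots> = 1 * y" using q by simp
  also have "\<dots> \<le> (real m - count_ge ps y) * y" using d y by (intro mult_right_mono) auto
  finally have volZ: "6 * y * (real m - count_ge ps y) \<le> (\<Sum>z\<in>?Z. ps ! z)"
    using vol by (simp add: algebra_simps)
  have "0 < 6 * y * (real m - count_ge ps y)" using y d by simp
  then have "?Z \<noteq> {}" using volZ by (intro notI) simp
  then obtain z where z: "z \<in> ?Z" by blast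
  have "card W < card ({..<?n} - M)" using W(1) z by (intro psubset_card_mono) auto
  then have "card W = 8 * q" using W(2) by auto
  moreover have "card M = m" using cM z by auto
  moreover have "ps ! z \<le> ps ! i" if "i \<in> M \<union> W" "z \<in> ?Z" for i z
    using that M(3)[of i z] W(3)[of i z] by auto
  ultimately show ?thesis using that M(1) W(1) out volZ by blast
qed

lemma ex_power_of_two:
  fixes a :: real
  assumes "1 \<le> a"
  obtains l :: nat where "a \<le> 2 ^ l" "2 ^ l < 2 * a"
proof -
  let ?P = "\<lambda>l. a \<le> (2::real) ^ l"
  obtain k where "?P k" using real_arch_pow[of 2 a] by (auto intro: less_imp_le)
  then have P: "?P (LEAST l. ?P l)" by (rule LeastI)
  have "2 ^ (LEAST l. ?P l) < 2 * a"
  proof (cases "LEAST l. ?P l")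
    case (Suc l)
    then have "\<not> ?P l" using not_less_Least[of l ?P] by simp
    then show ?thesis using Suc by simp
  qed (use assms in simp)
  with P show ?thesis using that by blast
qed

section \<open>Arrival orders and the thresholds they yield\<close>

lemma length_arrival [simp]: "length (arrival ps \<sigma>) = length ps"
  by (simp add: arrival_def)

lemma nth_arrival [simp]: "t < length ps \<Longrightarrow> arrival ps \<sigma> ! t = ps ! \<sigma> t"
  by (simp add: arrival_def)

lemma arrival_nonneg:
  assumes "\<forall>x\<in>set ps. 0 \<le> x" "\<sigma> permutes {..<length ps}"
  shows "\<forall>x\<in>set (arrival ps \<sigma>). 0 \<le> x"
  using assms permutes_in_image[OF assms(2)] by (auto simp: arrival_def)

lemma count_ge_arrival:
  assumes "\<sigma> permutes {..<length ps}"
  shows "count_ge (arrival ps \<sigma>) x = count_ge ps x"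
  unfolding count_ge_def
proof (rule bij_betw_same_card[of \<sigma>])
  have img: "\<sigma> ` {t. t < length ps \<and> x \<le> ps ! \<sigma> t} = {i. i < length ps \<and> x \<le> ps ! i}" (is "?A = ?B")
  proof
    show "?A \<subseteq> ?B" using permutes_in_image[OF assms] by auto
    show "?B \<subseteq> ?A"
    proof
      fix i assume i: "i \<in> ?B"
      then obtain t where "t < length ps" "\<sigma> t = i"
        using permutes_image[OF assms] by (metis (lifting) imageE lessThan_iff mem_Collect_eq)
      with i show "i \<in> ?A" by auto
    qed
  qed
  have "{i. i < length (arrival ps \<sigma>) \<and> x \<le> arrival ps \<sigma> ! i} = {t. t < length ps \<and> x \<le> ps ! \<sigma> t}"
    by auto
  then show "bij_betw \<sigma> {i. i < length (arrival ps \<sigma>) \<and> x \<le> arrival ps \<sigma> ! i}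
      {i. i < length ps \<and> x \<le> ps ! i}"
    using img inj_on_subset[OF permutes_inj[OF assms]] by (simp add: bij_betw_def)
qed

text \<open>By \<open>rank\<close> the quantile is at least every job of \<open>Z\<close> and at
  most \<open>y / (8 * q)\<close>. So the volume \<open>v\<close> below it is at least that of the
  sampled part of \<open>Z\<close> and at most \<open>vol_lt ps y\<close>, and some power of two
  yields a suitable threshold. The unsampled part of \<open>Z\<close> fills the reserved
  machines.\<close>

lemma good_order_min_load:
  fixes ps :: "real list" and y :: real and m q e d r :: nat and M W :: "nat set"
  defines "n \<equiv> length ps"
  defines "Z \<equiv> {..<n} - M - W"
  defines "w \<equiv> \<lambda>i. if i \<in> Z then ps ! i else 0"
  assumes nn: "\<forall>x\<in>set ps. 0 \<le> x" and y: "y > 0" and q: "q > 0" and m: "m > 0"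
    and \<sigma>: "\<sigma> permutes {..<n}"
    and sets: "M \<subseteq> {..<n}" "W \<subseteq> {..<n} - M"
    and out: "\<And>i. i < n \<Longrightarrow> i \<notin> M \<Longrightarrow> ps ! i < y / (8 * q)"
    and Z_le: "\<And>i z. i \<in> M \<union> W \<Longrightarrow> z \<in> Z \<Longrightarrow> ps ! z \<le> ps ! i"
    and d: "d > 0" "m = d + count_ge ps y"
    and vol: "6 * y * d \<le> (\<Sum>z\<in>Z. ps ! z)" "vol_lt ps y \<le> 16 * y * m"
    and rank: "card {t. t < n div 2 \<and> \<sigma> t \<in> M} \<le> r" "r < card {t. t < n div 2 \<and> \<sigma> t \<in> M \<union> W}"
    and sample: "(\<Sum>z\<in>Z. ps ! z) / 4 \<le> (\<Sum>t<n div 2. w (\<sigma> t))"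
      "(\<Sum>t<n div 2. w (\<sigma> t)) \<le> 3 / 4 * (\<Sum>z\<in>Z. ps ! z)"
    and e: "d \<le> e" "e \<le> 2 * d"
  shows "\<exists>l. (2::real) ^ l \<le> 64 * m \<and>
    y / 4 \<le> min_load m (arrival ps \<sigma>) (run_det (cover_alg m e l r) n [] [] (arrival ps \<sigma>))"
proof -
  define xs where "xs = arrival ps \<sigma>"
  define h where "h = n div 2"
  have hn: "h \<le> n" by (simp add: h_def)
  have len: "length xs = n" by (simp add: xs_def n_def)
  have nth: "xs ! t = ps ! \<sigma> t" if "t < n" for t using that by (simp add: xs_def n_def)
  have ps_nn: "0 \<le> ps ! i" if "i < n" for i using nn that by (simp add: n_def)
  have \<sigma>_less: "\<sigma> t < n \<longleftrightarrow> t < n" for t using permutes_in_image[OF \<sigma>, of t] by simp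
  have xs_nn: "\<forall>x\<in>set xs. 0 \<le> x" unfolding xs_def using arrival_nonneg nn \<sigma> n_def by blast
  have inj: "inj_on \<sigma> A" for A using permutes_inj[OF \<sigma>] inj_on_subset by blast
  define sm where "sm = take h xs"
  have sm: "length sm = h" "\<And>t. t < h \<Longrightarrow> sm ! t = ps ! \<sigma> t"
    using hn len nth by (auto simp: sm_def)
  define \<theta> where "\<theta> = quantile sm r"
  let ?C = "{t. t < h \<and> \<sigma> t \<in> M \<union> W}" and ?A = "{t. t < h \<and> \<sigma> t \<in> M}"
  have A_out: "sm ! t \<le> y / (8 * q)" if "t < length sm" "t \<notin> ?A" for t
    using out[of "\<sigma> t"] \<sigma>_less that hn by (simp add: sm)
  have Z_bound: "ps ! z \<le> \<theta>" if "z \<in> Z" for z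
    unfolding \<theta>_def
  proof (rule quantile_bounds(1)[where C = ?C and A = ?A and \<beta> = "y / (8 * q)"])
    show "ps ! z \<le> sm ! t" if "t \<in> ?C" for t using Z_le[of "\<sigma> t" z] that \<open>z \<in> Z\<close> sm by simp
  qed (use rank A_out sm in \<open>auto simp: h_def\<close>)
  have \<theta>_le: "\<theta> \<le> y / (8 * q)"
    unfolding \<theta>_def
  proof (rule quantile_bounds(2)[where C = ?C and A = ?A and \<gamma> = 0])
    show "0 \<le> sm ! t" if "t \<in> ?C" for t using ps_nn[of "\<sigma> t"] \<sigma>_less that sm hn by simp
  qed (use rank A_out sm in \<open>auto simp: h_def\<close>)
  have yq: "y / (8 * q) < y / 4" using y q by (simp add: field_simps)
  define v where "v = sample_vol sm r"
  have v_eq: "v = (\<Sum>t | t < h \<and> ps ! \<sigma> t \<le> \<theta>. ps ! \<sigma> t)"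
    unfolding v_def sample_vol_def \<theta>_def[symmetric] using sm by (intro sum.cong) auto
  have "(\<Sum>t<h. w (\<sigma> t)) = (\<Sum>t\<in>{t\<in>{..<h}. \<sigma> t \<in> Z}. ps ! \<sigma> t)"
    unfolding w_def by (rule sum.inter_filter[symmetric]) simp
  also have "\<dots> \<le> v"
    unfolding v_eq using Z_bound ps_nn \<sigma>_less hn by (intro sum_mono2) auto
  finally have v_ge: "3 / 2 * y * d \<le> v" using sample(1) vol(1) by (simp add: h_def)
  have "v = (\<Sum>i\<in>\<sigma> ` {t. t < h \<and> ps ! \<sigma> t \<le> \<theta>}. ps ! i)"
    unfolding v_eq by (simp add: sum.reindex[OF inj])
  also have "\<dots> \<le> vol_lt ps y"
    unfolding vol_lt_def using \<theta>_le yq y \<sigma>_less hn ps_nn by (intro sum_mono2) (auto simp: n_def)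
  finally have v_le: "v \<le> 16 * y * m" using vol(2) by simp
  have "y * 1 \<le> y * d" using y d by (intro mult_left_mono) auto
  then have yv: "3 / 2 * y \<le> v" using v_ge by simp
  then have "1 \<le> 2 * v / y" using y by (simp add: field_simps)
  \<comment> \<open>Aiming at \<open>2 * v / y\<close> and overshooting by less than a factor 2
    gives \<open>y / 4 < T\<close> and \<open>T \<le> y / 2\<close>.\<close>
  then obtain l :: nat where l: "2 * v / y \<le> 2 ^ l" "2 ^ l < 2 * (2 * v / y)"
    by (rule ex_power_of_two)
  have "4 * v / y \<le> 4 * (16 * y * m) / y" using v_le y by (intro divide_right_mono) auto
  then have l_le: "(2::real) ^ l \<le> 64 * m" using l(2) y by simp
  define T where "T = v / 2 ^ l"
  have T: "y / 4 < T" "T \<le> y / 2" using l y by (auto simp: T_def field_simps)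
  have total: "(\<Sum>t<n. w (\<sigma> t)) = (\<Sum>z\<in>Z. ps ! z)"
  proof -
    have "(\<Sum>t<n. w (\<sigma> t)) = (\<Sum>i<n. w i)"
      using sum.permute[OF \<sigma>, of w] by (simp add: o_def)
    also have "\<dots> = (\<Sum>i\<in>{i\<in>{..<n}. i \<in> Z}. ps ! i)"
      unfolding w_def by (rule sum.inter_filter[symmetric]) simp
    also have "{i\<in>{..<n}. i \<in> Z} = Z" by (auto simp: Z_def)
    finally show ?thesis .
  qed
  have split: "(\<Sum>t<n. w (\<sigma> t)) = (\<Sum>t<h. w (\<sigma> t)) + (\<Sum>t\<in>{h..<n}. w (\<sigma> t))"
    using sum.atLeastLessThan_concat[of 0 h n "\<lambda>t. w (\<sigma> t)"] hn by (simp add: atLeast0LessThan)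
  \<comment> \<open>The reserve needs at most \<open>2 * d * (3 / 4 * y)\<close>, a quarter of
    \<open>6 * y * d\<close>. The second half of the order has at least that share of
    \<open>Z\<close>, since the sample took at most 3/4.\<close>
  have "real e \<le> 2 * real d" using e(2) by linarith
  then have "e * (y / 4 + T) \<le> 2 * d * (y / 4 + T)" using y T by (intro mult_right_mono) auto
  also have "\<dots> \<le> 2 * d * (y / 4 + y / 2)" using T by (intro mult_left_mono) auto
  also have "\<dots> \<le> (\<Sum>z\<in>Z. ps ! z) / 4" using vol(1) by simp
  also have "\<dots> \<le> (\<Sum>t\<in>{h..<n}. w (\<sigma> t))" using split total sample(2) by (simp add: h_def)
  also have "\<dots> = (\<Sum>t\<in>{t\<in>{h..<n}. \<sigma> t \<in> Z}. xs ! t)"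
    unfolding w_def by (subst sum.inter_filter) (auto intro!: sum.cong simp: nth)
  also have "\<dots> \<le> (\<Sum>t | h \<le> t \<and> t < n \<and> xs ! t < T. xs ! t)"
  proof (rule sum_mono2)
    show "{t\<in>{h..<n}. \<sigma> t \<in> Z} \<subseteq> {t. h \<le> t \<and> t < n \<and> xs ! t < T}"
      using out yq T(1) \<sigma>_less by (fastforce simp: nth Z_def)
  qed (use ps_nn \<sigma>_less nth in auto)
  finally have small: "e * (y / 4 + T) \<le> \<dots>" .
  \<comment> \<open>As \<open>T \<le> y\<close>, the \<open>m - d\<close> jobs of size at least
    \<open>y\<close> are available for the other machines.\<close>
  have "count_ge ps y \<le> count_ge xs T"
  proof -
    have "count_ge xs T = count_ge ps T" unfolding xs_def using count_ge_arrival \<sigma> n_def by blast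
    moreover have "count_ge ps y \<le> count_ge ps T"
      using T y by (intro count_ge_antimono) simp
    ultimately show ?thesis by simp
  qed
  then have large: "m \<le> e + count_ge xs T" using d e by simp
  have T_eq: "T = sample_vol (take (length xs div 2) xs) r / 2 ^ l"
    by (simp add: T_def v_def sm_def h_def len)
  have "y / 4 \<le> min_load m xs (run_det (cover_alg m e l r) (length xs) [] [] xs)"
    by (rule cover_alg_min_load[OF m xs_nn T_eq])
      (use T y large small d e in \<open>simp_all add: len h_def\<close>)
  then show ?thesis using l_le unfolding len unfolding xs_def by blast
qed

text \<open>Chebyshev's inequality controls the number of sampled jobs of \<open>M\<close>, that of
  \<open>W\<close>, and the sampled volume of \<open>Z\<close>. Each condition fails for at most 1/8
  of the orders, and the union bound leaves more than half.\<close>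

lemma card_good_orders:
  fixes ps :: "real list" and y :: real and m q :: nat and M W :: "nat set"
  defines "n \<equiv> length ps"
  defines "Z \<equiv> {..<n} - M - W"
  defines "w \<equiv> \<lambda>i. if i \<in> Z then ps ! i else 0"
  defines "v \<equiv> (\<Sum>z\<in>Z. ps ! z)"
  assumes nn: "\<forall>x\<in>set ps. 0 \<le> x" and y: "y > 0" and q: "q \<ge> 8" and m: "m > 0" "m \<le> q ^ 4"
    and sets: "M \<subseteq> {..<n}" "W \<subseteq> {..<n} - M" "card M = m" "card W = 8 * q"
    and out: "\<And>i. i < n \<Longrightarrow> i \<notin> M \<Longrightarrow> ps ! i < y / (8 * q)"
    and vol: "6 * y \<le> v"
  shows "fact n / 2 \<le> real (card {\<sigma>. \<sigma> permutes {..<n} \<and>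
      \<bar>real (card {t. t < n div 2 \<and> \<sigma> t \<in> M}) - m / 2\<bar> \<le> 2 * (real q)\<^sup>2 + 1 / 2 \<and>
      q \<le> card {t. t < n div 2 \<and> \<sigma> t \<in> W} \<and>
      v / 4 \<le> (\<Sum>t<n div 2. w (\<sigma> t)) \<and> (\<Sum>t<n div 2. w (\<sigma> t)) \<le> 3 / 4 * v})"
    (is "_ \<le> real (card ?Good)")
proof -
  define h where "h = n div 2"
  have hn: "h \<le> n" by (simp add: h_def)
  have fins: "finite M" "finite W" "finite Z"
    using sets(1,2) by (auto simp: Z_def intro: finite_subset[OF _ finite_lessThan[of n]])
  have n: "n \<ge> m + 8 * q"
  proof -
    have "card (M \<union> W) = m + 8 * q" using sets fins by (subst card_Un_disjoint) auto
    moreover have "card (M \<union> W) \<le> card {..<n}" using sets by (intro card_mono) auto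
    ultimately show ?thesis by simp
  qed
  have n8: "n \<ge> 8" using n q by simp
  have hlow: "(real n - 1) / (2 * n) \<le> h / n" "real h / n \<le> 1 / 2"
  proof -
    have "n \<le> 2 * h + 1" "2 * h \<le> n" unfolding h_def by auto
    then have "real n \<le> real (2 * h + 1)" "real (2 * h) \<le> real n" by (simp_all only: of_nat_le_iff)
    then have "(real n - 1) / 2 \<le> h" "real h \<le> real n / 2" by simp_all
    then have "(real n - 1) / 2 / n \<le> h / n" "real h / n \<le> real n / 2 / n"
      by (intro divide_right_mono; simp)+
    then show "(real n - 1) / (2 * n) \<le> h / n" "real h / n \<le> 1 / 2" using n8 by simp_all
  qed
  \<comment> \<open>As \<open>m \<le> n\<close>, rounding \<open>n / 2\<close> down shifts the mean
    by at most 1/2; hence the summand 1/2 in the first condition.\<close>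
  have hm: "m / 2 - 1 / 2 \<le> h / n * m" "h / n * m \<le> m / 2"
  proof -
    have "m / 2 - 1 / 2 \<le> (real n - 1) / (2 * n) * m" using n n8 by (simp add: field_simps)
    also have "\<dots> \<le> h / n * m" using hlow(1) by (intro mult_right_mono) auto
    finally show "m / 2 - 1 / 2 \<le> h / n * m" .
    show "h / n * m \<le> m / 2" using mult_right_mono[OF hlow(2), of m] by simp
  qed
  have h38: "3 / 8 \<le> real h / n"
  proof -
    have "3 / 8 \<le> (real n - 1) / (2 * n)" using n8 by (simp add: field_simps)
    with hlow(1) show ?thesis by linarith
  qed
  define X where "X u \<sigma> = (\<Sum>t<h. u (\<sigma> t)) - h / n * (\<Sum>k<n. u k)" for u :: "nat \<Rightarrow> real" and \<sigma>
  define Bad where "Bad u \<delta> = {\<sigma>. \<sigma> permutes {..<n} \<and> \<delta> \<le> \<bar>X u \<sigma>\<bar>}" for u :: "nat \<Rightarrow> real" and \<delta>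
  \<comment> \<open>Since \<open>h / n \<le> 1 / 2\<close>, the variance is at most half the sum of
    squares, which explains the factor 2.\<close>
  have Bad_le: "real (card (Bad u \<delta>)) \<le> fact n * b"
    if "\<delta> > 0" "(\<Sum>k<n. (u k)\<^sup>2) \<le> 2 * b * \<delta>\<^sup>2" for u \<delta> b
  proof -
    have "card (Bad u \<delta>) * \<delta>\<^sup>2 \<le> fact n * (h / n * (\<Sum>k<n. (u k)\<^sup>2))"
      unfolding Bad_def X_def by (rule card_sample_deviation_le[OF hn that(1)])
    also have "\<dots> \<le> fact n * (1 / 2 * (2 * b * \<delta>\<^sup>2))"
      using that hlow by (intro mult_left_mono mult_mono) (auto intro!: sum_nonneg)
    finally show ?thesis using that(1) by simp
  qed
  define iM iW where "iM i = (if i \<in> M then 1 else 0 :: real)" and "iW i = (if i \<in> W then 1 else 0 :: real)" for i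
  have ind: "(\<Sum>k<n. if k \<in> A then f k else 0) = (\<Sum>k\<in>A. f k)" if "A \<subseteq> {..<n}" for A and f :: "nat \<Rightarrow> real"
  proof -
    have "(\<Sum>k<n. if k \<in> A then f k else 0) = (\<Sum>k\<in>{k\<in>{..<n}. k \<in> A}. f k)"
      by (rule sum.inter_filter[symmetric]) simp
    also have "{k\<in>{..<n}. k \<in> A} = A" using that by auto
    finally show ?thesis .
  qed
  have sub: "M \<subseteq> {..<n}" "W \<subseteq> {..<n}" "Z \<subseteq> {..<n}" using sets by (auto simp: Z_def)
  have sq_if: "(if b then x else 0)\<^sup>2 = (if b then x\<^sup>2 else 0)" for b and x :: real by simp
  have tot: "(\<Sum>k<n. iM k) = m" "(\<Sum>k<n. iW k) = 8 * real q" "(\<Sum>k<n. w k) = v"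
    "(\<Sum>k<n. (iM k)\<^sup>2) = m" "(\<Sum>k<n. (iW k)\<^sup>2) = 8 * real q" "(\<Sum>k<n. (w k)\<^sup>2) = (\<Sum>k\<in>Z. (ps ! k)\<^sup>2)"
    unfolding iM_def iW_def w_def v_def sq_if by (simp_all add: ind sub sets)
  have cnt: "(\<Sum>t<h. if \<sigma> t \<in> A then 1 else 0 :: real) = card {t. t < h \<and> \<sigma> t \<in> A}" for \<sigma> :: "nat \<Rightarrow> nat" and A
    by (subst sum.inter_filter[symmetric]) auto
  have v: "v > 0" using vol y by simp
  have q': "real q \<ge> 8" using q by simp
  \<comment> \<open>As \<open>m \<le> q ^ 4\<close>, the standard deviation is at most of order
    \<open>q\<^sup>2\<close>.\<close>
  have bad1: "real (card (Bad iM (2 * (real q)\<^sup>2))) \<le> fact n * (1 / 8)"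
  proof (rule Bad_le)
    have "real m \<le> real (q ^ 4)" using m(2) of_nat_mono by blast
    then show "(\<Sum>k<n. (iM k)\<^sup>2) \<le> 2 * (1 / 8) * (2 * (real q)\<^sup>2)\<^sup>2"
      unfolding tot by (simp add: power_mult_distrib)
  qed (use q in simp)
  have bad2: "real (card (Bad iW (2 * real q))) \<le> fact n * (1 / 8)"
  proof (rule Bad_le)
    have "8 * real q \<le> real q * real q" using q' by (intro mult_right_mono) auto
    then show "(\<Sum>k<n. (iW k)\<^sup>2) \<le> 2 * (1 / 8) * (2 * real q)\<^sup>2"
      unfolding tot by (simp add: power2_eq_square)
  qed (use q in simp)
  have bad3: "real (card (Bad w (v / 8))) \<le> fact n * (1 / 8)"
  proof (rule Bad_le)
    \<comment> \<open>Jobs of \<open>Z\<close> are below \<open>y / 64\<close> because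
      \<open>q \<ge> 8\<close>, and \<open>y\<close> is at most a sixth of \<open>v\<close>. With
      such small jobs the volume concentrates.\<close>
    have "(\<Sum>k\<in>Z. (ps ! k)\<^sup>2) \<le> (\<Sum>k\<in>Z. y / 64 * ps ! k)"
    proof (rule sum_mono)
      fix k assume k: "k \<in> Z"
      have "ps ! k < y / (8 * q)" "0 \<le> ps ! k" using k out nn by (auto simp: Z_def n_def)
      moreover have "y / (8 * q) \<le> y / 64" using q' y by (intro divide_left_mono) auto
      ultimately show "(ps ! k)\<^sup>2 \<le> y / 64 * ps ! k"
        unfolding power2_eq_square by (intro mult_right_mono) auto
    qed
    also have "\<dots> = y / 64 * v" by (simp add: v_def sum_distrib_left)
    also have "\<dots> \<le> v / 256 * v" using vol v y by (intro mult_right_mono) auto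
    finally show "(\<Sum>k<n. (w k)\<^sup>2) \<le> 2 * (1 / 8) * (v / 8)\<^sup>2"
      unfolding tot by (simp add: power2_eq_square)
  qed (use v in simp)
  let ?P = "{\<sigma>. \<sigma> permutes {..<n}}"
  let ?B = "Bad iM (2 * (real q)\<^sup>2) \<union> Bad iW (2 * real q) \<union> Bad w (v / 8)"
  have fin: "finite ?P" by (simp add: finite_permutations)
  have "?P - ?B \<subseteq> ?Good"
  proof
    fix \<sigma> assume s: "\<sigma> \<in> ?P - ?B"
    then have 1: "\<bar>X iM \<sigma>\<bar> < 2 * (real q)\<^sup>2" and 2: "\<bar>X iW \<sigma>\<bar> < 2 * real q" and 3: "\<bar>X w \<sigma>\<bar> < v / 8"
      by (auto simp: Bad_def)
    have "\<bar>real (card {t. t < h \<and> \<sigma> t \<in> M}) - m / 2\<bar> \<le> 2 * (real q)\<^sup>2 + 1 / 2"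
      using 1 hm unfolding X_def tot unfolding iM_def cnt by linarith
    moreover have "q \<le> card {t. t < h \<and> \<sigma> t \<in> W}"
    proof -
      \<comment> \<open>The mean is at least \<open>3 * q\<close>, and a deviation below
        \<open>2 * q\<close> leaves \<open>q\<close>.\<close>
      have "3 / 8 * (8 * real q) \<le> h / n * (8 * real q)" using h38 by (intro mult_right_mono) auto
      then have "real q \<le> card {t. t < h \<and> \<sigma> t \<in> W}"
        using 2 unfolding X_def tot unfolding iW_def cnt by simp
      then show ?thesis by simp
    qed
    moreover have "v / 4 \<le> (\<Sum>t<h. w (\<sigma> t)) \<and> (\<Sum>t<h. w (\<sigma> t)) \<le> 3 / 4 * v"
    proof -
      have "3 / 8 * v \<le> h / n * v" "h / n * v \<le> 1 / 2 * v"
        using h38 hlow v by (intro mult_right_mono; simp)+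
      then show ?thesis using 3 unfolding X_def tot by linarith
    qed
    ultimately show "\<sigma> \<in> ?Good" using s by (simp add: h_def)
  qed
  then have "card (?P - ?B) \<le> card ?Good"
    by (intro card_mono) (auto intro: finite_subset[OF _ fin])
  moreover have "card ?P - card ?B \<le> card (?P - ?B)"
    by (rule diff_card_le_card_Diff) (auto simp: Bad_def intro: finite_subset[OF _ fin])
  moreover have "card ?B \<le> card (Bad iM (2 * (real q)\<^sup>2)) + card (Bad iW (2 * real q)) + card (Bad w (v / 8))"
    by (meson add_le_mono1 card_Un_le le_trans)
  moreover have "real (card ?P) = fact n" by (simp add: card_permutations)
  ultimately show ?thesis using bad1 bad2 bad3 by linarith
qed

text \<open>The grid of ranks has spacing \<open>q\<close>, so it cannot skip a window of length
  \<open>b \<ge> q\<close>. It starts at or below \<open>a\<close>, even if the subtraction is cut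
  off at 0, and \<open>8 * q\<close> points reach far enough since \<open>a\<close> is at most
  \<open>5 * q\<^sup>2 + 1\<close> above the start.\<close>

lemma ex_rank_in_window:
  fixes m q a b :: nat
  assumes q: "q \<ge> 1" and a: "\<bar>real a - m / 2\<bar> \<le> 2 * (real q)\<^sup>2 + 1 / 2" and b: "q \<le> b"
  shows "\<exists>u<8 * q. a \<le> m div 2 - 3 * q\<^sup>2 + u * q \<and> m div 2 - 3 * q\<^sup>2 + u * q < a + b"
proof -
  define r0 where "r0 = m div 2 - 3 * q\<^sup>2"
  have qq: "1 \<le> q\<^sup>2" using q by simp
  have "real m / 2 - 1 / 2 \<le> real (m div 2)" "real (m div 2) \<le> real m / 2" by linarith+
  then have "real (m div 2) \<le> real (a + 2 * q\<^sup>2 + 1)" "real a \<le> real (m div 2 + 2 * q\<^sup>2 + 1)"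
    using a by simp_all
  then have "m div 2 \<le> a + 2 * q\<^sup>2 + 1" "a \<le> m div 2 + 2 * q\<^sup>2 + 1"
    by (simp_all only: of_nat_le_iff)
  then have r0: "r0 \<le> a" "a - r0 \<le> 5 * q\<^sup>2 + 1" using qq unfolding r0_def by linarith+
  \<comment> \<open>The quotient of \<open>a - r0\<close> by \<open>q\<close>, rounded up.\<close>
  define u where "u = (a - r0 + (q - 1)) div q"
  have u1: "a - r0 \<le> u * q"
  proof -
    have "a - r0 + (q - 1) < (u + 1) * q"
      unfolding u_def using q dividend_less_div_times[of q "a - r0 + (q - 1)"] by (simp add: algebra_simps)
    then show ?thesis using q by (simp add: algebra_simps)
  qed
  have u2: "u * q \<le> a - r0 + (q - 1)" unfolding u_def by simp
  have "u * q \<le> 5 * q\<^sup>2 + q" using u2 r0(2) q by linarith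
  also have "\<dots> \<le> 6 * q * q" using q by (simp add: power2_eq_square)
  finally have "u \<le> 6 * q" using q by simp
  then have "u < 8 * q" using q by simp
  moreover have "a \<le> r0 + u * q" "r0 + u * q < a + b" using u1 u2 r0(1) b q by linarith+
  ultimately show ?thesis unfolding r0_def by blast
qed

section \<open>The competitive ratio\<close>

text \<open>The three independent guesses: the number of reserved machines, the exponent
  \<open>l\<close> in the threshold, and the index of a rank on the grid of
  \<open>ex_rank_in_window\<close>.\<close>

definition seeds :: "nat \<Rightarrow> nat \<Rightarrow> (nat \<times> nat \<times> nat) set" where
  "seeds K q = {..<K} \<times> {..<K} \<times> {..<8 * q}"

text \<open>The first component i of the seed encodes e: i = 0 gives e = 0, and i = k + 1 gives
  e = 2 ^ k.\<close>

definition seeded_alg :: "nat \<Rightarrow> nat \<Rightarrow> nat \<times> nat \<times> nat \<Rightarrow> det_alg" where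
  "seeded_alg m q = (\<lambda>(i, l, u). cover_alg m (2 ^ i div 2) l (m div 2 - 3 * q\<^sup>2 + u * q))"

lemma finite_seeds: "finite (seeds K q)"
  by (simp add: seeds_def)

lemma card_seeds: "card (seeds K q) = K * K * (8 * q)"
  by (simp add: seeds_def)

lemma rom_value_behavioural:
  assumes "finite S" "S \<noteq> {}"
  shows "rom_value m (behavioural (pmf_of_set S) f) ps =
    (\<Sum>\<sigma> | \<sigma> permutes {..<length ps}.
      (\<Sum>s\<in>S. min_load m (arrival ps \<sigma>) (run_det (f s) (length ps) [] [] (arrival ps \<sigma>))) / card S)
    / fact (length ps)"
proof -
  have ne: "{\<sigma>. \<sigma> permutes {..<length ps}} \<noteq> {}" using permutes_id by blast
  have fin: "finite {\<sigma>. \<sigma> permutes {..<length ps}}" by (simp add: finite_permutations)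
  have "alg_value m (behavioural (pmf_of_set S) f) xs =
      (\<Sum>s\<in>S. min_load m xs (run_det (f s) (length xs) [] [] xs)) / card S" for xs
    unfolding alg_value_def run_alg_behavioural
    by (simp add: integral_pmf_of_set[OF assms(2,1)])
  then show ?thesis
    unfolding rom_value_def
    by (simp add: integral_pmf_of_set[OF ne fin] card_permutations sum_divide_distrib[symmetric])
qed

text \<open>If at least \<open>m\<close> jobs reach \<open>y / (8 * q)\<close>, the greedy seeds
  suffice. Otherwise at least half of the orders are good, and each has a seed that gives
  \<open>y / 4\<close>, which is drawn with probability \<open>1 / (8 * K\<^sup>2 * q)\<close>.
  Together with \<open>OPT m ps \<le> 8 * y\<close> this yields the factor
  \<open>512 = 8 * 2 * 4 * 8\<close>.\<close>

lemma OPT_le_rom_value: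
  fixes m q K :: nat
  assumes nn: "\<forall>x\<in>set ps. 0 \<le> x" and q: "q \<ge> 8" "m \<le> q ^ 4" and m: "m > 0" and K: "128 * m \<le> 2 ^ K"
  defines "A \<equiv> behavioural (pmf_of_set (seeds K q)) (seeded_alg m q)"
  shows "OPT m ps \<le> 512 * (real K)\<^sup>2 * real q * rom_value m A ps"
proof -
  define n where "n = length ps"
  define g where "g \<sigma> s = min_load m (arrival ps \<sigma>) (run_det (seeded_alg m q s) n [] [] (arrival ps \<sigma>))"
    for \<sigma> s
  let ?P = "{\<sigma>. \<sigma> permutes {..<n}}"
  let ?S = "seeds K q"
  have K0: "K > 0" using K m by (intro gr0I) simp
  have S: "?S \<noteq> {}" using K0 q by (auto simp: seeds_def lessThan_empty_iff)
  have finP: "finite ?P" by (simp add: finite_permutations)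
  have cardP: "real (card ?P) = fact n" by (simp add: card_permutations)
  have g_nn: "0 \<le> g \<sigma> s" if "\<sigma> \<in> ?P" for \<sigma> s
    unfolding g_def using that nn m by (intro min_load_nonneg arrival_nonneg) (auto simp: n_def)
  have rom: "rom_value m A ps = (\<Sum>\<sigma>\<in>?P. \<Sum>s\<in>?S. g \<sigma> s) / (real (card ?S) * fact n)"
    unfolding A_def rom_value_behavioural[OF finite_seeds S] g_def n_def
    by (simp add: sum_divide_distrib[symmetric])
  have cardS: "real (card ?S) = 8 * (real K)\<^sup>2 * real q" by (simp add: card_seeds power2_eq_square)
  have rom_nn: "0 \<le> rom_value m A ps"
    unfolding rom using g_nn by (intro divide_nonneg_nonneg sum_nonneg) auto
  show ?thesis
  proof (cases "OPT m ps > 0")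
    case False
    then show ?thesis using rom_nn by (meson mult_nonneg_nonneg not_less of_nat_0_le_iff order_trans zero_le_numeral zero_le_power)
  next
    case True
    then obtain y where y: "OPT m ps / 8 \<le> y" "8 * y * (real m - count_ge ps y) \<le> vol_lt ps y"
        "vol_lt ps y \<le> 16 * y * m"
      using ex_scale[OF nn m] by blast
    have y0: "y > 0" using y True by simp
    show ?thesis
    proof (cases "count_ge ps (y / (8 * q)) < m")
      case False
      \<comment> \<open>The greedy seeds, a share of \<open>1 / K\<close> of all seeds.\<close>
      let ?G = "{0::nat} \<times> {..<K} \<times> {..<8 * q}"
      let ?c = "y / (8 * q)"
      have g_ge: "?c \<le> g \<sigma> s" if "\<sigma> \<in> ?P" "s \<in> ?G" for \<sigma> s
      proof -
        obtain l u where s: "s = (0, l, u)" using \<open>s \<in> ?G\<close> by auto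
        have "?c \<le> min_load m (arrival ps \<sigma>)
          (run_det (cover_alg m 0 l (m div 2 - 3 * q\<^sup>2 + u * q)) (length (arrival ps \<sigma>)) [] [] (arrival ps \<sigma>))"
          using that False nn
          by (intro greedy_min_load[OF m arrival_nonneg]) (auto simp: count_ge_arrival n_def)
        then show ?thesis by (simp add: g_def s seeded_alg_def n_def)
      qed
      have "(\<Sum>\<sigma>\<in>?P. \<Sum>s\<in>?G. ?c) \<le> (\<Sum>\<sigma>\<in>?P. \<Sum>s\<in>?G. g \<sigma> s)"
        by (intro sum_mono g_ge)
      also have "\<dots> \<le> (\<Sum>\<sigma>\<in>?P. \<Sum>s\<in>?S. g \<sigma> s)"
        using K0 g_nn finite_seeds by (intro sum_mono sum_mono2) (auto simp: seeds_def)
      finally have "fact n * (K * y) \<le> (\<Sum>\<sigma>\<in>?P. \<Sum>s\<in>?S. g \<sigma> s)"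
        using q cardP by (simp add: card_cartesian_product)
      then have "fact n * (K * y) / (real (card ?S) * fact n) \<le> rom_value m A ps"
        unfolding rom by (intro divide_right_mono) auto
      also have "fact n * (K * y) / (real (card ?S) * fact n) = y / (8 * real K * real q)"
        using K0 by (simp add: cardS power2_eq_square)
      finally have "y \<le> 8 * real K * real q * rom_value m A ps"
        using K0 q by (simp add: divide_le_eq mult_ac)
      then have "OPT m ps \<le> 64 * real K * real q * rom_value m A ps" using y(1) by simp
      also have "\<dots> \<le> 512 * (real K)\<^sup>2 * real q * rom_value m A ps"
      proof -
        have "1 * real K \<le> real K * real K" using K0 by (intro mult_right_mono) auto
        then have "64 * real K \<le> 512 * (real K)\<^sup>2" by (simp add: power2_eq_square)
        then show ?thesis using rom_nn by (intro mult_right_mono) auto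
      qed
      finally show ?thesis .
    next
      case few: True
      have q0: "q > 0" using q by simp
      obtain M W where MW: "M \<subseteq> {..<n}" "W \<subseteq> {..<n} - M" "card M = m" "card W = 8 * q"
        "\<And>i. i < n \<Longrightarrow> i \<notin> M \<Longrightarrow> ps ! i < y / (8 * q)"
        "\<And>i z. i \<in> M \<union> W \<Longrightarrow> z \<in> {..<n} - M - W \<Longrightarrow> ps ! z \<le> ps ! i"
        "6 * y * (real m - count_ge ps y) \<le> (\<Sum>z\<in>{..<n} - M - W. ps ! z)"
        using ex_window[OF nn y0 q0 few y(2)] unfolding n_def by metis
      define d where "d = m - count_ge ps y"
      have "count_ge ps y \<le> count_ge ps (y / (8 * q))"
        using y0 q by (intro count_ge_antimono) (simp add: divide_le_eq)
      then have d: "d > 0" "m = d + count_ge ps y" using few by (auto simp: d_def)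
      have vol: "6 * y * d \<le> (\<Sum>z\<in>{..<n} - M - W. ps ! z)" using MW(7) d by simp
      have "6 * y * 1 \<le> 6 * y * d" using y0 d by (intro mult_left_mono) auto
      then have vol1: "6 * y \<le> (\<Sum>z\<in>{..<n} - M - W. ps ! z)" using vol by simp
      obtain k :: nat where k: "real d \<le> 2 ^ k" "2 ^ k < 2 * real d"
        using ex_power_of_two[of d] d by auto
      have "real d \<le> real (2 ^ k)" "real (2 ^ k) \<le> real (2 * d)" using k by simp_all
      then have k': "d \<le> 2 ^ k" "2 ^ k \<le> 2 * d" by (simp_all only: of_nat_le_iff)
      have "(2::nat) ^ (k + 1) \<le> 4 * d" using k'(2) by simp
      also have "\<dots> < 2 ^ K" using d K m by linarith
      finally have kK: "k + 1 < K" by (simp only: power_strict_increasing_iff)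
      define Good where "Good = {\<sigma>. \<sigma> permutes {..<n} \<and>
        \<bar>real (card {t. t < n div 2 \<and> \<sigma> t \<in> M}) - m / 2\<bar> \<le> 2 * (real q)\<^sup>2 + 1 / 2 \<and>
        q \<le> card {t. t < n div 2 \<and> \<sigma> t \<in> W} \<and>
        (\<Sum>z\<in>{..<n} - M - W. ps ! z) / 4 \<le> (\<Sum>t<n div 2. if \<sigma> t \<in> {..<n} - M - W then ps ! \<sigma> t else 0) \<and>
        (\<Sum>t<n div 2. if \<sigma> t \<in> {..<n} - M - W then ps ! \<sigma> t else 0) \<le> 3 / 4 * (\<Sum>z\<in>{..<n} - M - W. ps ! z)}"
      have card_Good: "fact n / 2 \<le> real (card Good)"
        unfolding Good_def n_def
        by (rule card_good_orders[OF nn y0 q(1) m q(2)]) (use MW vol1 in \<open>auto simp: n_def\<close>)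
      have "y / 4 \<le> (\<Sum>s\<in>?S. g \<sigma> s)" if \<sigma>: "\<sigma> \<in> Good" for \<sigma>
      proof -
        have \<sigma>P: "\<sigma> \<in> ?P" using \<sigma> by (simp add: Good_def)
        let ?a = "card {t. t < n div 2 \<and> \<sigma> t \<in> M}" and ?b = "card {t. t < n div 2 \<and> \<sigma> t \<in> W}"
        have "\<exists>u<8 * q. ?a \<le> m div 2 - 3 * q\<^sup>2 + u * q \<and> m div 2 - 3 * q\<^sup>2 + u * q < ?a + ?b"
          using \<sigma> q by (intro ex_rank_in_window) (simp_all add: Good_def)
        then obtain u where u: "u < 8 * q" "?a \<le> m div 2 - 3 * q\<^sup>2 + u * q"
          "m div 2 - 3 * q\<^sup>2 + u * q < ?a + ?b" by blast
        have ab: "?a + ?b = card {t. t < n div 2 \<and> \<sigma> t \<in> M \<union> W}"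
          using MW(2) by (subst card_Un_disjoint[symmetric]) (auto intro!: arg_cong[where f = card])
        have u': "m div 2 - 3 * q\<^sup>2 + u * q < card {t. t < n div 2 \<and> \<sigma> t \<in> M \<union> W}"
          using u(3) unfolding ab .
        have "\<exists>l. (2::real) ^ l \<le> 64 * m \<and> y / 4 \<le> min_load m (arrival ps \<sigma>)
          (run_det (cover_alg m (2 ^ k) l (m div 2 - 3 * q\<^sup>2 + u * q)) (length ps) [] [] (arrival ps \<sigma>))"
          unfolding n_def[symmetric]
          by (rule good_order_min_load[where ps = ps and M = M and W = W and q = q and d = d, folded n_def,
                OF nn y0 q0 m _ MW(1,2,5,6) d vol y(3) u(2) u' _ _ k'])
            (use \<sigma> in \<open>simp_all add: Good_def\<close>)
        then obtain l where l: "(2::real) ^ l \<le> 64 * m" "y / 4 \<le> min_load m (arrival ps \<sigma>)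
          (run_det (cover_alg m (2 ^ k) l (m div 2 - 3 * q\<^sup>2 + u * q)) n [] [] (arrival ps \<sigma>))"
          unfolding n_def by blast
        have "(2::real) ^ l \<le> real (64 * m)" using l(1) by simp
        \<comment> \<open>The bound \<open>64 * m\<close> on \<open>2 ^ l\<close> is the reason for
          demanding \<open>128 * m \<le> 2 ^ K\<close>.\<close>
        also have "\<dots> < real (2 ^ K)" using K m by (intro of_nat_less_iff[THEN iffD2]) linarith
        finally have "(2::real) ^ l < 2 ^ K" by simp
        then have lK: "l < K" by (simp only: power_strict_increasing_iff)
        have "y / 4 \<le> g \<sigma> (k + 1, l, u)" using l(2) by (simp add: g_def seeded_alg_def)
        also have "\<dots> \<le> (\<Sum>s\<in>?S. g \<sigma> s)"
          using u(1) kK lK g_nn[OF \<sigma>P] finite_seeds by (intro member_le_sum) (auto simp: seeds_def)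
        finally show ?thesis .
      qed
      then have "card Good * (y / 4) \<le> (\<Sum>\<sigma>\<in>Good. \<Sum>s\<in>?S. g \<sigma> s)"
        by (intro sum_bounded_below) auto
      also have "\<dots> \<le> (\<Sum>\<sigma>\<in>?P. \<Sum>s\<in>?S. g \<sigma> s)"
        using g_nn finP by (intro sum_mono2 sum_nonneg) (auto simp: Good_def)
      finally have "fact n / 2 * (y / 4) \<le> (\<Sum>\<sigma>\<in>?P. \<Sum>s\<in>?S. g \<sigma> s)"
        using mult_right_mono[OF card_Good, of "y / 4"] y0 by linarith
      then have "fact n / 2 * (y / 4) / (real (card ?S) * fact n) \<le> rom_value m A ps"
        unfolding rom by (intro divide_right_mono) auto
      also have "fact n / 2 * (y / 4) / (real (card ?S) * fact n) = y / (64 * (real K)\<^sup>2 * real q)"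
        by (simp add: cardS)
      finally have "y \<le> 64 * (real K)\<^sup>2 * real q * rom_value m A ps"
        using K0 q by (simp add: divide_le_eq mult_ac)
      then show ?thesis using y(1) by simp
    qed
  qed
qed

text \<open>If \<open>rom_value m A ps\<close> is 0, so is the optimum, and the ratio is 1 by
  convention. This case is why \<open>c \<ge> 1\<close> is demanded.\<close>

lemma comp_ratio_le:
  fixes c :: real
  assumes "m > 0" "c \<ge> 1"
    and "\<And>ps. \<forall>x\<in>set ps. 0 \<le> x \<Longrightarrow> OPT m ps \<le> c * rom_value m A ps"
  shows "comp_ratio m A \<le> ereal c"
  unfolding comp_ratio_def
proof (rule SUP_least)
  fix ps :: "real list" assume "ps \<in> {ps. \<forall>x\<in>set ps. 0 \<le> x}"
  then have nn: "\<forall>x\<in>set ps. 0 \<le> x" by simp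
  have "0 \<le> OPT m ps" "OPT m ps \<le> c * rom_value m A ps"
    using OPT_nonneg[OF nn assms(1)] assms(3)[OF nn] by auto
  moreover from this have "0 \<le> rom_value m A ps"
    using assms(2) by (metis less_le_trans linorder_not_less mult_pos_neg order_trans zero_less_one)
  ultimately show "ratio (OPT m ps) (rom_value m A ps) \<le> ereal c"
    using assms(2) by (auto simp: ratio_def divide_le_eq)
qed

theorem theorem1:
  shows "\<exists>A :: nat \<Rightarrow> online_alg. \<exists>C :: real. \<exists>k :: nat.
           \<forall>\<^sub>F m in sequentially. valid_alg m (A m) \<and>
             comp_ratio m (A m) \<le> ereal (C * real m powr (1/4) * ln (real m) ^ k)"
proof -
  define q where "q m = nat \<lceil>real m powr (1 / 4)\<rceil>" for m :: nat
  \<comment> \<open>The summand 7 provides the factor \<open>128 = 2 ^ 7\<close>.\<close>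
  define K where "K m = nat \<lceil>log 2 m\<rceil> + 7" for m :: nat
  define A where "A m = behavioural (pmf_of_set (seeds (K m) (q m))) (seeded_alg m (q m))" for m
  \<comment> \<open>The bound \<open>4096 = 8 ^ 4\<close> gives \<open>q m \<ge> 8\<close>. The
    constant is \<open>512 * 10 ^ 2 * 2\<close>, from the bounds on \<open>K m\<close> and
    \<open>q m\<close>.\<close>
  have "valid_alg m (A m) \<and> comp_ratio m (A m) \<le> ereal (102400 * real m powr (1 / 4) * ln (real m) ^ 2)"
    if m: "m \<ge> 4096" for m
  proof
    have m0: "m > 0" using m by simp
    show "valid_alg m (A m)"
      unfolding A_def using cover_alg_less[OF m0]
      by (intro valid_alg_behavioural) (auto simp: seeded_alg_def split: prod.splits)
    have root4: "(real m powr (1 / 4)) ^ 4 = m"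
      using m0 by (simp add: powr_realpow[symmetric] powr_powr)
    have root8: "8 \<le> real m powr (1 / 4)"
    proof (rule power_le_imp_le_base)
      show "8 ^ Suc 3 \<le> (real m powr (1 / 4)) ^ Suc 3" using root4 m by simp
    qed simp
    have q_ge: "real m powr (1 / 4) \<le> q m" and q_le: "q m \<le> 2 * real m powr (1 / 4)"
      using root8 unfolding q_def by linarith+
    have q8: "q m \<ge> 8" using q_ge root8 by linarith
    have "real m \<le> real (q m) ^ 4" using power_mono[OF q_ge, of 4] root4 by simp
    then have q4: "m \<le> q m ^ 4" by (metis of_nat_le_iff of_nat_power)
    have K2: "128 * m \<le> 2 ^ K m"
    proof -
      have "real m = 2 powr (log 2 m)" using m0 by simp
      also have "\<dots> \<le> 2 powr (real (nat \<lceil>log 2 m\<rceil>))" by (intro powr_mono) linarith+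
      also have "\<dots> = 2 ^ nat \<lceil>log 2 m\<rceil>" by (simp add: powr_realpow)
      finally have "real m \<le> real (2 ^ nat \<lceil>log 2 m\<rceil>)" by simp
      then have "m \<le> 2 ^ nat \<lceil>log 2 m\<rceil>" by (simp only: of_nat_le_iff)
      then show ?thesis by (simp add: K_def power_add)
    qed
    have ln1: "1 \<le> ln (real m)"
    proof -
      have "exp 1 \<le> real m" using exp_le m by linarith
      then show ?thesis using m0 by (simp add: ln_ge_iff)
    qed
    have "log 2 m \<le> 2 * ln m"
    proof -
      have "1 / 2 \<le> ln (2::real)" using exp_half_le2 by (subst ln_ge_iff) auto
      then have "ln m * (1 / 2) \<le> ln m * ln 2" using ln1 by (intro mult_left_mono) auto
      then show ?thesis by (simp add: log_def field_simps)
    qed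
    moreover have "0 \<le> log 2 m" using m by simp
    \<comment> \<open>Rounding up adds at most 1, so \<open>K m \<le> 2 * ln m + 8\<close>, and
      \<open>1 \<le> ln m\<close> absorbs the 8.\<close>
    ultimately have K_le: "real (K m) \<le> 10 * ln m" unfolding K_def using ln1 by linarith
    have "comp_ratio m (A m) \<le> ereal (512 * (real (K m))\<^sup>2 * real (q m))"
    proof (rule comp_ratio_le[OF m0])
      have "1 * 1 \<le> (512 * (real (K m))\<^sup>2) * real (q m)"
      proof (rule mult_mono)
        have "1 \<le> real (K m)" by (simp add: K_def)
        from one_le_power[OF this, of 2] show "1 \<le> 512 * (real (K m))\<^sup>2" by linarith
      qed (use q8 in auto)
      then show "1 \<le> 512 * (real (K m))\<^sup>2 * real (q m)" by simp
      show "OPT m ps \<le> 512 * (real (K m))\<^sup>2 * real (q m) * rom_value m (A m) ps"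
        if "\<forall>x\<in>set ps. 0 \<le> x" for ps
        unfolding A_def using OPT_le_rom_value[OF that q8 q4 m0 K2] by simp
    qed
    also have "512 * (real (K m))\<^sup>2 * real (q m) \<le> 512 * (10 * ln m)\<^sup>2 * (2 * real m powr (1 / 4))"
      using power_mono[OF K_le, of 2] q_le by (intro mult_mono) auto
    also have "\<dots> = 102400 * real m powr (1 / 4) * ln m ^ 2" by (simp add: power_mult_distrib)
    finally show "comp_ratio m (A m) \<le> ereal (102400 * real m powr (1 / 4) * ln (real m) ^ 2)"
      by simp
  qed
  then have "\<forall>\<^sub>F m in sequentially. valid_alg m (A m) \<and>
      comp_ratio m (A m) \<le> ereal (102400 * real m powr (1 / 4) * ln (real m) ^ 2)"
    unfolding eventually_sequentially by blast
  then show ?thesis by blast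
qed

end
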